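(* Let $\mathbb{K}$ be a field, let $G$ be a graph with vertex set $\{v_1,\dots,v_n\}$, and let $I=I(G)\subseteq S=\mathbb{K}[x_1,\dots,x_n]$ be its edge ideal. Suppose that $p$ is the number of bipartite connected components of $G$. Then for every integer $k\geq 0$, we have $\mathrm{sdepth}(I^k/I^{k+1})\geq p$.
   Context: Graphs are finite and simple. The edge ideal $I(G)$ is the ideal of $S=\mathbb{K}[x_1,\dots,x_n]$ generated by the squarefree monomials $x_ix_j$ with $\{v_i,v_j\}$ an edge of $G$; $I^0=S$. An isolated vertex counts as a bipartite connected component. Stanley depth: let $M$ be a finitely generated $\mathbb{Z}^n$-graded $S$-module, $u\in M$ a homogeneous element and $Z\subseteq\{x_1,\dots,x_n\}$. The $\mathbb{K}$-subspace $u\mathbb{K}[Z]$ generated by all $uv$ with $v\in\mathbb{K}[Z]$ is called a Stanley space of dimension $|Z|$ if it is a free $\mathbb{K}[Z]$-module. A Stanley decomposition $\mathcal{D}$ of $M$ is a decomposition of $M$ (as a $\mathbb{K}$-vector space) as a finite direct sum of Stanley spaces; $\mathrm{sdepth}(\mathcal{D})$ is the minimum dimension of a Stanley space in $\mathcal{D}$, and $\mathrm{sdepth}(M)$ is the maximum of $\mathrm{sdepth}(\mathcal{D})$ over all Stanley decompositions $\mathcal{D}$ of $M$. Convention: $\mathrm{sdepth}(0)=+\infty$ (the zero module occurs here only when $G$ has no edges and $k\ge 1$). *)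

theory Defs
  imports
    "HOL-Algebra.Ideal_Product"
    "HOL-Algebra.Module"
    "HOL-Library.Poly_Mapping"
    "HOL-Library.Extended_Nat"
begin

section \<open>Graphs\<close>

definition simple_graph :: "'v set \<Rightarrow> 'v set set \<Rightarrow> bool" where
  "simple_graph V E \<longleftrightarrow> finite V \<and> E \<subseteq> {e. e \<subseteq> V \<and> card e = 2}"

definition graph_components :: "'v set \<Rightarrow> 'v set set \<Rightarrow> 'v set set" where
  "graph_components V E = V // {(u, v) \<in> V \<times> V. (u, v) \<in> {(x, y). {x, y} \<in> E}\<^sup>*}"

text \<open>Bipartiteness of the subgraph induced on \<open>C\<close>. One side may be empty, so that
  an isolated vertex is bipartite.\<close>

definition bipartite_on :: "'v set set \<Rightarrow> 'v set \<Rightarrow> bool" where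
  "bipartite_on E C \<longleftrightarrow>
     (\<exists>X Y. C = X \<union> Y \<and> X \<inter> Y = {} \<and> (\<forall>e\<in>E. e \<subseteq> C \<longrightarrow> (\<exists>x\<in>X. \<exists>y\<in>Y. e = {x, y})))"


section \<open>Polynomial rings and edge ideals\<close>

text \<open>A monomial is its exponent vector, a polynomial a finitely supported map from monomials to
  coefficients; multiplication is the convolution product provided by
  \<^theory>\<open>HOL-Library.Poly_Mapping\<close>.\<close>

type_synonym ('v, 'k) mpoly = "('v \<Rightarrow>\<^sub>0 nat) \<Rightarrow>\<^sub>0 'k"

text \<open>For \<open>Z \<subseteq> V\<close>, \<open>mpoly_ring Z\<close> is a subring of \<open>mpoly_ring V\<close>.\<close>

definition mpoly_ring :: "'v set \<Rightarrow> ('v, 'k::field) mpoly ring" where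
  "mpoly_ring Z =
     \<lparr>carrier = {f. \<forall>t\<in>Poly_Mapping.keys f. Poly_Mapping.keys t \<subseteq> Z},
      mult = (*), one = 1, zero = 0, add = (+)\<rparr>"

definition mpoly_var :: "'v \<Rightarrow> ('v, 'k::field) mpoly" where
  "mpoly_var x = Poly_Mapping.single (Poly_Mapping.single x 1) 1"

definition edge_ideal :: "'v set \<Rightarrow> 'v set set \<Rightarrow> ('v, 'k::field) mpoly set" where
  "edge_ideal V E = Idl\<^bsub>mpoly_ring V\<^esub> {mpoly_var x * mpoly_var y |x y. {x, y} \<in> E}"

text \<open>The zeroth power of an ideal is the whole ring, the unit of the monoid of ideals.\<close>

definition ideal_power :: "('a, 'b) ring_scheme \<Rightarrow> 'a set \<Rightarrow> nat \<Rightarrow> 'a set" where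
  "ideal_power R I k = I [^]\<^bsub>ideals_set R\<^esub> k"

text \<open>The homogeneous component of the polynomial ring in degree \<open>a\<close>. Degrees are integer vectors,
  and components in degrees that are not exponent vectors of monomials in \<open>V\<close> are zero.\<close>

definition mpoly_component :: "'v set \<Rightarrow> ('v \<Rightarrow>\<^sub>0 int) \<Rightarrow> ('v, 'k::field) mpoly set" where
  "mpoly_component V a =
     {f \<in> carrier (mpoly_ring V). \<forall>t\<in>Poly_Mapping.keys f. Poly_Mapping.map int t = a}"


section \<open>Quotients of ideals as modules\<close>

definition ideal_module :: "('a, 'b) ring_scheme \<Rightarrow> 'a set \<Rightarrow> ('a, 'a) module" where
  "ideal_module R I =
     \<lparr>carrier = I, mult = mult R, one = one R, zero = zero R, add = add R, smult = mult R\<rparr>"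

text \<open>The module record extends the ring record; the fields \<open>mult\<close> and \<open>one\<close> play no role for
  modules.\<close>

definition quotient_module :: "('a, 'b) module \<Rightarrow> 'b set \<Rightarrow> ('a, 'b set) module" where
  "quotient_module M N =
     \<lparr>carrier = a_rcosets\<^bsub>M\<^esub> N, mult = undefined, one = undefined, zero = N, add = set_add M,
      smult = (\<lambda>r X. \<Union>x\<in>X. N +>\<^bsub>M\<^esub> (r \<odot>\<^bsub>M\<^esub> x))\<rparr>"

definition ideal_quotient ::
    "'v set \<Rightarrow> ('v, 'k::field) mpoly set \<Rightarrow> ('v, 'k) mpoly set \<Rightarrow>
     (('v, 'k) mpoly, ('v, 'k) mpoly set) module" where
  "ideal_quotient V I J = quotient_module (ideal_module (mpoly_ring V) I) J"

text \<open>The multigrading that \<open>I / J\<close> inherits from the polynomial ring, for \<open>J \<subseteq> I\<close>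
  monomial ideals.\<close>

definition ideal_quotient_component ::
    "'v set \<Rightarrow> ('v, 'k::field) mpoly set \<Rightarrow> ('v, 'k) mpoly set \<Rightarrow> ('v \<Rightarrow>\<^sub>0 int) \<Rightarrow>
     ('v, 'k) mpoly set set" where
  "ideal_quotient_component V I J a =
     (\<lambda>f. J +>\<^bsub>mpoly_ring V\<^esub> f) ` (I \<inter> mpoly_component V a)"


section \<open>Stanley depth\<close>

definition free_module :: "('a, 'c) ring_scheme \<Rightarrow> ('a, 'b, 'd) module_scheme \<Rightarrow> bool" where
  "free_module R M \<longleftrightarrow> Module.module R M \<and>
     (\<exists>B \<subseteq> carrier M. \<forall>x\<in>carrier M.
        \<exists>!c. c \<in> B \<rightarrow>\<^sub>E carrier R \<and> finite {b\<in>B. c b \<noteq> \<zero>\<^bsub>R\<^esub>} \<and>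
             x = (\<Oplus>\<^bsub>M\<^esub>b\<in>{b\<in>B. c b \<noteq> \<zero>\<^bsub>R\<^esub>}. c b \<odot>\<^bsub>M\<^esub> b))"

text \<open>In what follows \<open>M\<close> is a module over \<open>mpoly_ring V\<close> whose homogeneous component in degree
  \<open>a\<close> is \<open>gr a\<close>, where \<open>a\<close> ranges over the integer vectors indexed by \<open>V\<close>.\<close>

definition stanley_subspace ::
    "(('v, 'k::field) mpoly, 'm) module \<Rightarrow> 'm \<Rightarrow> 'v set \<Rightarrow> 'm set" where
  "stanley_subspace M u Z = {v \<odot>\<^bsub>M\<^esub> u |v. v \<in> carrier (mpoly_ring Z)}"

definition is_stanley_space ::
    "'v set \<Rightarrow> (('v, 'k::field) mpoly, 'm) module \<Rightarrow> (('v \<Rightarrow>\<^sub>0 int) \<Rightarrow> 'm set) \<Rightarrow>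
     'm \<Rightarrow> 'v set \<Rightarrow> bool" where
  "is_stanley_space V M gr u Z \<longleftrightarrow>
     u \<in> carrier M \<and> (\<exists>a. Poly_Mapping.keys a \<subseteq> V \<and> u \<in> gr a) \<and> Z \<subseteq> V \<and>
     free_module (mpoly_ring Z :: ('v, 'k) mpoly ring) (M\<lparr>carrier := stanley_subspace M u Z\<rparr>)"

text \<open>A decomposition is a finite set of pairs \<open>(u, Z)\<close>; directness of the sum means that every
  element of \<open>M\<close> is a sum of elements of the Stanley spaces in exactly one way.\<close>

definition stanley_decomposition ::
    "'v set \<Rightarrow> (('v, 'k::field) mpoly, 'm) module \<Rightarrow> (('v \<Rightarrow>\<^sub>0 int) \<Rightarrow> 'm set) \<Rightarrow>
     ('m \<times> 'v set) set \<Rightarrow> bool" where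
  "stanley_decomposition V M gr D \<longleftrightarrow>
     finite D \<and> (\<forall>(u, Z)\<in>D. is_stanley_space V M gr u Z) \<and>
     (\<forall>m\<in>carrier M. \<exists>!w. w \<in> (\<Pi>\<^sub>E (u, Z)\<in>D. stanley_subspace M u Z) \<and>
                           m = (\<Oplus>\<^bsub>M\<^esub>d\<in>D. w d))"

definition sdepth_decomposition :: "('m \<times> 'v set) set \<Rightarrow> enat" where
  "sdepth_decomposition D = (INF (u, Z)\<in>D. enat (card Z))"

text \<open>For a nonzero module with a Stanley decomposition the supremum is taken over a nonempty set of
  numbers bounded by the number of variables, so it is a maximum. The zero module has the empty
  decomposition, so its Stanley depth is \<open>\<infinity>\<close>.\<close>

definition sdepth ::
    "'v set \<Rightarrow> (('v, 'k::field) mpoly, 'm) module \<Rightarrow> (('v \<Rightarrow>\<^sub>0 int) \<Rightarrow> 'm set) \<Rightarrow> enat" where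
  "sdepth V M gr = (SUP D\<in>{D. stanley_decomposition V M gr D}. sdepth_decomposition D)"

end

theory Submission
  imports Defs "HOL-Library.Multiset" "HOL-Library.Disjoint_Sets"
begin

text \<open>All ideals involved are monomial, so it suffices to partition, for every \<open>k\<close>, the set of
  exponent vectors \<open>a\<close> of order \<open>k\<close> into finitely many cones of dimension at least \<open>p\<close>; here the
  order of \<open>a\<close> is the largest number of edges, counted with multiplicity, whose product divides
  \<open>x\<^sup>a\<close>. The order is additive over the connected components, so products of partitions for
  the single components reduce the problem to one component, where a cone of dimension one is needed
  only in the bipartite case. For a bipartite component the weighted Koenig theorem provides a vertex
  cover of weight \<open>k\<close>, and the exponent of a vertex outside the cover can be increased without
  changing the order. Hence every \<open>a\<close> of order \<open>k\<close> is the origin of a coordinate ray of vectors of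
  order \<open>k\<close>. Membership depends only on the exponents cut off at \<open>k + 1\<close>, which makes the
  resulting partition into cones finite.\<close>

section \<open>Vertex covers and products of edges\<close>

text \<open>The obstacle is that the free direction depends on \<open>a\<close> and that rays in
  different directions overlap, so the rays alone are no partition. What helps is that the order is
  monotone: with two comparable vectors a level set contains everything between them, and the
  directions can be handled one at a time. Bipartiteness enters through the equality in the Koenig
  theorem. The weight of a cover always bounds the order from above, but in a triangle with
  \<open>a = (1,1,1)\<close> the order is 1, every cover has weight at least 2, and raising any one
  exponent by 1 gives order 2, so there is no ray at all. The cut-off comes from the absence of
  loops: a product of \<open>j\<close> edges has exponents at most \<open>j\<close>, so divisibility
  by it cannot distinguish exponents beyond \<open>j\<close>, and order \<open>k\<close> is decided
  by the cases \<open>j = k\<close> and \<open>j = k + 1\<close>. A cone with origin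
  \<open>u\<close> and directions \<open>Z\<close> stands for the residue class of
  \<open>x^u\<close> times \<open>K[Z]\<close>; this is free because no monomial of the cone lies in
  the smaller ideal.\<close>

definition exponent_restrict :: "'v set \<Rightarrow> ('v \<Rightarrow>\<^sub>0 'c::zero) \<Rightarrow> 'v \<Rightarrow>\<^sub>0 'c" where
  "exponent_restrict S f = Poly_Mapping.mapp (\<lambda>x c. if x \<in> S then c else 0) f"

lemma lookup_exponent_restrict [simp]:
  "poly_mapping.lookup (exponent_restrict S f) x = (if x \<in> S then poly_mapping.lookup f x else 0)"
  by (simp add: exponent_restrict_def lookup_mapp in_keys_iff when_def)

lemma keys_exponent_restrict [simp]:
  "Poly_Mapping.keys (exponent_restrict S f) = Poly_Mapping.keys f \<inter> S"
  by (auto simp: in_keys_iff split: if_splits)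

definition edge_monomials :: "'v set set \<Rightarrow> ('v \<Rightarrow>\<^sub>0 nat) set" where
  "edge_monomials E = {Poly_Mapping.single x 1 + Poly_Mapping.single y 1 |x y. {x, y} \<in> E}"

text \<open>Exponents of the monomials in the \<open>k\<close>-th power of the edge ideal. The
  remainder \<open>r\<close> is not tied to a vertex set; the support condition is added separately
  in \<open>monomial_ideal\<close> and \<open>level_exponents\<close>.\<close>

definition power_exponents :: "'v set set \<Rightarrow> nat \<Rightarrow> ('v \<Rightarrow>\<^sub>0 nat) set" where
  "power_exponents E k =
     {sum_mset m + r |m r. size m = k \<and> set_mset m \<subseteq> edge_monomials E}"

lemma power_exponents_0 [simp]: "power_exponents E 0 = UNIV"
  by (auto simp: power_exponents_def)

lemma power_exponents_add_right: "a \<in> power_exponents E k \<Longrightarrow> a + b \<in> power_exponents E k"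
  unfolding power_exponents_def by (auto simp: add.assoc) (metis add.assoc)

lemma power_exponents_mono: "E \<subseteq> F \<Longrightarrow> power_exponents E k \<subseteq> power_exponents F k"
  unfolding power_exponents_def edge_monomials_def by blast

lemma power_exponents_add:
  assumes "a \<in> power_exponents E i" and "b \<in> power_exponents E j"
  shows "a + b \<in> power_exponents E (i + j)"
proof -
  from assms obtain m r m' r' where
    "a = sum_mset m + r" "size m = i" "set_mset m \<subseteq> edge_monomials E"
    "b = sum_mset m' + r'" "size m' = j" "set_mset m' \<subseteq> edge_monomials E"
    unfolding power_exponents_def by blast
  then have "a + b = sum_mset (m + m') + (r + r')" "size (m + m') = i + j"
    "set_mset (m + m') \<subseteq> edge_monomials E"
    by (auto simp: algebra_simps)
  then show ?thesis unfolding power_exponents_def by blast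
qed

lemma edge_monomials_subset_power_exponents: "edge_monomials E \<subseteq> power_exponents E 1"
proof
  fix e assume "e \<in> edge_monomials E"
  then have "e = sum_mset {#e#} + 0" "size {#e#} = 1" "set_mset {#e#} \<subseteq> edge_monomials E" by auto
  then show "e \<in> power_exponents E 1" unfolding power_exponents_def by blast
qed

text \<open>The inductions on \<open>k\<close> below peel off one edge by this rule and do not touch
  the multiset again.\<close>

lemma power_exponents_Suc_split:
  assumes "a \<in> power_exponents E (Suc k)"
  obtains e b where "e \<in> edge_monomials E" "b \<in> power_exponents E k" "a = b + e"
proof -
  from assms obtain m r where m: "a = sum_mset m + r" "size m = Suc k"
    "set_mset m \<subseteq> edge_monomials E"
    unfolding power_exponents_def by blast
  then obtain e m' where "m = add_mset e m'" by (metis size_eq_Suc_imp_eq_union)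
  with m have "a = (sum_mset m' + r) + e" "e \<in> edge_monomials E"
    "sum_mset m' + r \<in> power_exponents E k"
    unfolding power_exponents_def by (auto simp: algebra_simps)
  with that show thesis by blast
qed

lemma power_exponents_antimono:
  assumes "i \<le> j" shows "power_exponents E j \<subseteq> power_exponents E i"
proof -
  have "power_exponents E (Suc k) \<subseteq> power_exponents E k" for k
    by (metis power_exponents_Suc_split power_exponents_add_right subsetI)
  then show ?thesis using assms lift_Suc_antimono_le by blast
qed

section \<open>Vertex covers and the weighted Koenig theorem\<close>

definition is_vertex_cover :: "'v set set \<Rightarrow> 'v set \<Rightarrow> bool" where
  "is_vertex_cover E K \<longleftrightarrow> (\<forall>e\<in>E. e \<inter> K \<noteq> {})"

definition weight :: "('v \<Rightarrow>\<^sub>0 nat) \<Rightarrow> 'v set \<Rightarrow> nat" where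
  "weight a K = (\<Sum>x\<in>K. poly_mapping.lookup a x)"

lemma weight_add: "weight (a + b) K = weight a K + weight b K"
  by (simp add: weight_def lookup_add sum.distrib)

lemma weight_mono: "finite L \<Longrightarrow> K \<subseteq> L \<Longrightarrow> weight a K \<le> weight a L"
  by (simp add: weight_def sum_mono2)

lemma weight_single [simp]:
  "finite K \<Longrightarrow> weight (Poly_Mapping.single x c) K = (if x \<in> K then c else 0)"
  by (simp add: weight_def lookup_single when_def)

lemma weight_restrict: "finite K \<Longrightarrow> weight (exponent_restrict S a) K = weight a (K \<inter> S)"
  by (simp add: weight_def sum.inter_restrict)

lemma weight_Un: "finite K \<Longrightarrow> finite L \<Longrightarrow> K \<inter> L = {} \<Longrightarrow> weight a (K \<union> L) = weight a K + weight a L"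
  by (simp add: weight_def sum.union_disjoint)

text \<open>Weak duality: each of the \<open>k\<close> edges meets \<open>K\<close> and contributes
  at least 1 to the weight.\<close>

lemma vertex_cover_weight_ge:
  assumes "is_vertex_cover E K" "finite K" "a \<in> power_exponents E k"
  shows "k \<le> weight a K"
  using assms(3)
proof (induction k arbitrary: a)
  case (Suc k)
  from Suc.prems obtain e b where e: "e \<in> edge_monomials E" "b \<in> power_exponents E k" "a = b + e"
    by (rule power_exponents_Suc_split)
  from e(1) obtain x y
    where xy: "e = Poly_Mapping.single x 1 + Poly_Mapping.single y 1" "{x, y} \<in> E"
    unfolding edge_monomials_def by blast
  then have "{x, y} \<inter> K \<noteq> {}" using assms(1) unfolding is_vertex_cover_def by blast
  then have "1 \<le> weight e K" using assms(2) by (auto simp: xy(1) weight_add)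
  with Suc.IH[OF e(2)] show ?case by (simp add: e(3) weight_add)
qed simp

text \<open>The exponents of \<open>a\<close> act as vertex capacities, and the conclusion asks for
  \<open>n\<close> edges, with repetition, that respect them. The induction on the total weight
  removes one edge that fits. Either the bound on the covers drops by at most one, or some cover is
  tight and cuts the problem into two smaller ones.\<close>

lemma weighted_konig:
  assumes "finite X" "finite Y" "X \<inter> Y = {}"
    and "\<forall>e\<in>E. \<exists>x\<in>X. \<exists>y\<in>Y. e = {x, y}"
    and "\<And>K. K \<subseteq> X \<union> Y \<Longrightarrow> is_vertex_cover E K \<Longrightarrow> n \<le> weight a K"
  shows "a \<in> power_exponents E n"
  using assms(5)
proof (induction "weight a (X \<union> Y)" arbitrary: a n rule: less_induct)
  case less
  note fin = assms(1,2)
  have sub: "finite K" if "K \<subseteq> X \<union> Y" for K using that fin finite_subset by blast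
  show ?case
  proof (cases n)
    case (Suc n')
    \<comment> \<open>Vertices of exponent 0 have total weight 0, which is below \<open>n\<close>,
      so they do not form a cover. An edge that avoids them has positive exponents at both ends and
      can be subtracted.\<close>
    define K0 where "K0 = {z \<in> X \<union> Y. poly_mapping.lookup a z = 0}"
    have "weight a K0 = 0" by (simp add: weight_def K0_def)
    then have "\<not> is_vertex_cover E K0" using less.prems[of K0] Suc by (force simp: K0_def)
    then obtain e where e: "e \<in> E" "e \<inter> K0 = {}" unfolding is_vertex_cover_def by blast
    then obtain u v where uv: "u \<in> X" "v \<in> Y" "e = {u, v}" using assms(4) by blast
    have pos: "0 < poly_mapping.lookup a u" "0 < poly_mapping.lookup a v"
      using e uv by (auto simp: K0_def)
    have "u \<noteq> v" using uv assms(3) by blast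
    define ee where "ee = Poly_Mapping.single u (1::nat) + Poly_Mapping.single v 1"
    define b where "b = a - ee"
    have a: "a = b + ee"
      by (rule poly_mapping_eqI)
        (use pos \<open>u \<noteq> v\<close> in \<open>auto simp: b_def ee_def lookup_add lookup_minus lookup_single when_def\<close>)
    have ee: "ee \<in> power_exponents E 1"
      using e(1) uv(3) edge_monomials_subset_power_exponents[of E]
      unfolding edge_monomials_def ee_def by blast
    have wee: "weight ee K = (if u \<in> K then 1 else 0) + (if v \<in> K then 1 else 0)" if "K \<subseteq> X \<union> Y"
      for K
      using sub[OF that] by (simp add: ee_def weight_add)
    show ?thesis
    proof (cases "\<forall>K \<subseteq> X \<union> Y. is_vertex_cover E K \<longrightarrow> n' \<le> weight b K")
      case True
      have "weight b (X \<union> Y) < weight a (X \<union> Y)"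
        using wee[of "X \<union> Y"] uv weight_add[of b ee "X \<union> Y"] by (simp flip: a)
      with less.hyps[of b n'] True have "b \<in> power_exponents E n'" by blast
      from power_exponents_add[OF this ee] show ?thesis by (metis a Suc Suc_eq_plus1)
    next
      case False
      then obtain K where K: "K \<subseteq> X \<union> Y" "is_vertex_cover E K" "weight b K < n'"
        by (meson not_le)
      \<comment> \<open>\<open>weight b K\<close> is at most \<open>n - 2\<close> and the removed
        edge adds at most 2, while \<open>weight a K\<close> is at least \<open>n\<close>. So
        equality holds throughout: \<open>K\<close> contains both ends of the edge and has weight
        exactly \<open>n\<close>.\<close>
      have "weight a K = weight b K + weight ee K" by (metis a weight_add)
      with less.prems[OF K(1,2)] K(3) Suc wee[OF K(1)]
      have uvK: "u \<in> K" "v \<in> K" and wK: "weight a K = n"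
        by (auto split: if_splits)
      \<comment> \<open>The cover \<open>K\<close> is tight for \<open>a\<close> and splits the vertex set into the two parts
        \<open>(X - K) \<union> (Y \<inter> K)\<close> and \<open>(X \<inter> K) \<union> (Y - K)\<close>. A cover of one part is completed by
        \<open>K\<close> to a cover of the whole graph, so the induction hypothesis applies to each part.\<close>
      define S where "S = K \<inter> X"
      define T where "T = K \<inter> Y"
      have ST: "K = S \<union> T" "S \<inter> T = {}" "S \<subseteq> X" "T \<subseteq> Y" "u \<in> S" "v \<in> T"
        using K(1) assms(3) uvK uv by (auto simp: S_def T_def)
      have finST: "finite S" "finite T" using ST fin finite_subset by blast+
      have n: "n = weight a S + weight a T"
        using wK ST(2) finST by (simp add: ST(1) weight_Un)
      define P where "P = (X - S) \<union> T"
      define Q where "Q = S \<union> (Y - T)"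
      have PQ: "P \<subseteq> X \<union> Y" "Q \<subseteq> X \<union> Y" "P \<inter> Q = {}" "P \<union> Q = X \<union> Y" "u \<notin> P" "v \<notin> Q"
        using ST assms(3) uv by (auto simp: P_def Q_def)
      define a1 where "a1 = exponent_restrict P a"
      define a2 where "a2 = exponent_restrict Q a"
      \<comment> \<open>The induction hypothesis requires strictly smaller weight. It is available
        because \<open>u\<close> lies outside \<open>P\<close>, \<open>v\<close> lies outside
        \<open>Q\<close>, and both have positive exponent.\<close>
      have lt: "weight (exponent_restrict R a) (X \<union> Y) < weight a (X \<union> Y)"
        if "R \<subseteq> X \<union> Y" "w \<in> X \<union> Y - R" "0 < poly_mapping.lookup a w" for R w
      proof -
        have "weight (exponent_restrict R a) (X \<union> Y) = weight a R"
          using fin that(1) by (simp add: weight_restrict Int_absorb1)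
        also have "\<dots> < weight a (insert w R)"
          using that sub[OF that(1)] by (simp add: weight_def)
        also have "\<dots> \<le> weight a (X \<union> Y)" using fin that by (intro weight_mono) auto
        finally show ?thesis .
      qed
      \<comment> \<open>An edge that misses \<open>S\<close> has its \<open>X\<close>-end in
        \<open>X - S\<close> and, since \<open>K\<close> covers it, its \<open>Y\<close>-end in
        \<open>T\<close>. Both ends are then in \<open>P\<close>, where \<open>L\<close> meets the
        edge. The argument for \<open>T\<close> and \<open>Q\<close> is symmetric.\<close>
      have cov: "is_vertex_cover E ((L \<inter> P) \<union> S)" "is_vertex_cover E ((L \<inter> Q) \<union> T)"
        if L: "is_vertex_cover E L" for L
      proof -
        have "e \<inter> ((L \<inter> P) \<union> S) \<noteq> {} \<and> e \<inter> ((L \<inter> Q) \<union> T) \<noteq> {}" if e: "e \<in> E" for e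
        proof -
          obtain x y where xy: "x \<in> X" "y \<in> Y" "e = {x, y}" using assms(4) e by blast
          have "e \<inter> L \<noteq> {}" "e \<inter> K \<noteq> {}"
            using e L K(2) unfolding is_vertex_cover_def by auto
          then show ?thesis using xy assms(3) ST unfolding P_def Q_def by auto
        qed
        then show "is_vertex_cover E ((L \<inter> P) \<union> S)" "is_vertex_cover E ((L \<inter> Q) \<union> T)"
          unfolding is_vertex_cover_def by blast+
      qed
      \<comment> \<open>Cancelling \<open>weight a S\<close> from
        \<open>n = weight a S + weight a T\<close> leaves the demand \<open>weight a T\<close> for
        the part \<open>P\<close>; dually the part \<open>Q\<close> gets \<open>weight a S\<close>,
        and the two demands add up to \<open>n\<close>.\<close>
      have "a1 \<in> power_exponents E (weight a T)" unfolding a1_def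
      proof (rule less.hyps)
        show "weight (exponent_restrict P a) (X \<union> Y) < weight a (X \<union> Y)"
          using lt[of P u] PQ uv pos by blast
        fix L assume L: "L \<subseteq> X \<union> Y" "is_vertex_cover E L"
        have "n \<le> weight a ((L \<inter> P) \<union> S)"
          using cov[OF L(2)] L(1) ST by (intro less.prems) auto
        also have "\<dots> \<le> weight a (L \<inter> P) + weight a S"
          using sub[OF L(1)] finST PQ by (subst weight_Un) (auto simp: Q_def)
        finally show "weight a T \<le> weight (exponent_restrict P a) L"
          using n sub[OF L(1)] by (simp add: weight_restrict)
      qed
      moreover have "a2 \<in> power_exponents E (weight a S)" unfolding a2_def
      proof (rule less.hyps)
        show "weight (exponent_restrict Q a) (X \<union> Y) < weight a (X \<union> Y)"
          using lt[of Q v] PQ uv pos by blast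
        fix L assume L: "L \<subseteq> X \<union> Y" "is_vertex_cover E L"
        have "n \<le> weight a ((L \<inter> Q) \<union> T)"
          using cov[OF L(2)] L(1) ST by (intro less.prems) auto
        also have "\<dots> \<le> weight a (L \<inter> Q) + weight a T"
          using sub[OF L(1)] finST PQ by (subst weight_Un) (auto simp: P_def)
        finally show "weight a S \<le> weight (exponent_restrict Q a) L"
          using n sub[OF L(1)] by (simp add: weight_restrict)
      qed
      ultimately have "a1 + a2 \<in> power_exponents E n"
        using n power_exponents_add by (metis add.commute)
      \<comment> \<open>Restricting to \<open>P\<close> and \<open>Q\<close> loses only the
        exponents outside \<open>X \<union> Y\<close>, which go into the remainder.\<close>
      moreover have "a = a1 + a2 + (a - (a1 + a2))"
        by (rule poly_mapping_eqI)
          (use PQ(3) in \<open>auto simp: a1_def a2_def lookup_add lookup_minus\<close>)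
      ultimately show ?thesis by (metis power_exponents_add_right)
    qed
  qed simp
qed

section \<open>Arithmetic of exponent vectors and the order\<close>

lemma keys_add_nat: "Poly_Mapping.keys (a + b) = Poly_Mapping.keys a \<union> Poly_Mapping.keys b"
  for a b :: "'v \<Rightarrow>\<^sub>0 nat"
  by (auto simp: in_keys_iff lookup_add)

lemma exponent_diff_add:
  fixes a b :: "'v \<Rightarrow>\<^sub>0 nat"
  assumes "\<And>x. poly_mapping.lookup b x \<le> poly_mapping.lookup a x"
  shows "a - b + b = a"
  by (rule poly_mapping_eqI) (simp add: lookup_add lookup_minus assms)

lemma exponent_restrict_add_left:
  assumes "Poly_Mapping.keys a \<subseteq> U" "Poly_Mapping.keys b \<inter> U = {}"
  shows "exponent_restrict U (a + b) = (a :: 'v \<Rightarrow>\<^sub>0 nat)"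
proof (rule poly_mapping_eqI)
  fix x
  show "poly_mapping.lookup (exponent_restrict U (a + b)) x = poly_mapping.lookup a x"
    using assms by (auto simp: lookup_add in_keys_iff disjoint_iff subset_iff)
qed

lemma exponent_restrict_split:
  fixes a :: "'v \<Rightarrow>\<^sub>0 nat"
  assumes "Poly_Mapping.keys a \<subseteq> U \<union> W" "U \<inter> W = {}"
  shows "a = exponent_restrict U a + exponent_restrict W a"
proof (rule poly_mapping_eqI)
  fix x
  show "poly_mapping.lookup a x = poly_mapping.lookup (exponent_restrict U a + exponent_restrict W a) x"
    using assms by (cases
      "x \<in> Poly_Mapping.keys a") (auto simp: lookup_add not_in_keys_iff_lookup_eq_zero)
qed

lemma exponent_add_inject:
  fixes a :: "'v \<Rightarrow>\<^sub>0 nat"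
  assumes "a + b = a' + b'" "U \<inter> W = {}"
    and "Poly_Mapping.keys a \<subseteq> U" "Poly_Mapping.keys a' \<subseteq> U"
    and "Poly_Mapping.keys b \<subseteq> W" "Poly_Mapping.keys b' \<subseteq> W"
  shows "a = a'" "b = b'"
proof -
  have "exponent_restrict U (a + b) = a" "exponent_restrict U (a' + b') = a'"
    by (rule exponent_restrict_add_left; use assms in blast)+
  then show "a = a'" using assms(1) by simp
  then show "b = b'" using assms(1) by simp
qed

definition edge_order :: "'v set set \<Rightarrow> ('v \<Rightarrow>\<^sub>0 nat) \<Rightarrow> nat" where
  "edge_order E a = Max {k. a \<in> power_exponents E k}"

lemma simple_graph_edgeD:
  assumes "simple_graph V E" "{x, y} \<in> E" shows "x \<noteq> y" "x \<in> V" "y \<in> V"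
  using assms unfolding simple_graph_def by force+

text \<open>The vertex set \<open>V\<close> is itself a cover, so its weight bounds all admissible
  numbers of edges and \<open>Max\<close> is attained; the admissible numbers are closed downwards.
  Statements about the order are reduced to \<open>power_exponents\<close> by this
  equivalence.\<close>

lemma le_edge_order_iff:
  assumes "simple_graph V E"
  shows "k \<le> edge_order E a \<longleftrightarrow> a \<in> power_exponents E k"
proof -
  have "is_vertex_cover E V" "finite V"
    using assms unfolding is_vertex_cover_def simple_graph_def
      by (auto simp: Int_absorb2 card_2_iff)
  then have "{k. a \<in> power_exponents E k} \<subseteq> {..weight a V}"
    using vertex_cover_weight_ge by blast
  then have fin: "finite {k. a \<in> power_exponents E k}" using finite_subset by blast
  moreover have "0 \<in> {k. a \<in> power_exponents E k}" by simp
  ultimately have "a \<in> power_exponents E (edge_order E a)"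
    unfolding edge_order_def using Max_in by blast
  then show ?thesis
    using fin power_exponents_antimono unfolding edge_order_def by (auto intro!: Max_ge)
qed

lemma edge_order_mono: "simple_graph V E \<Longrightarrow> edge_order E a \<le> edge_order E (a + b)"
  by (meson le_edge_order_iff order_refl power_exponents_add_right)

text \<open>A peeled-off edge is supported in \<open>U \<union> W\<close>, hence by
  \<open>sep\<close> on one side, and so divides one summand alone; the induction goes on with that
  summand divided by the edge. Only edges inside \<open>U \<union> W\<close> are constrained, since
  \<open>U\<close> and \<open>W\<close> will be unions of some of the components.\<close>

lemma power_exponents_add_split:
  assumes "a + b \<in> power_exponents E k"
    and "Poly_Mapping.keys a \<subseteq> U" "Poly_Mapping.keys b \<subseteq> W" "U \<inter> W = {}"
    and sep: "\<And>e. e \<in> E \<Longrightarrow> e \<subseteq> U \<union> W \<Longrightarrow> e \<subseteq> U \<or> e \<subseteq> W"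
  shows "\<exists>i j. i + j = k \<and> a \<in> power_exponents E i \<and> b \<in> power_exponents E j"
  using assms(1-3)
proof (induction k arbitrary: a b)
  case (Suc k)
  from Suc.prems(1) obtain e c
    where e: "e \<in> edge_monomials E" "c \<in> power_exponents E k" "a + b = c + e"
    by (rule power_exponents_Suc_split)
  from e(1) obtain x y
    where xy: "e = Poly_Mapping.single x 1 + Poly_Mapping.single y 1" "{x, y} \<in> E"
    unfolding edge_monomials_def by blast
  have ke: "Poly_Mapping.keys e = {x, y}" by (auto simp: xy(1) keys_add_nat)
  have e1: "e \<in> power_exponents E 1" using e(1) edge_monomials_subset_power_exponents by blast
  have le: "poly_mapping.lookup e z \<le> poly_mapping.lookup a z + poly_mapping.lookup b z" for z
    using arg_cong[OF e(3), of "\<lambda>f. poly_mapping.lookup f z"] by (simp add: lookup_add)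
  have "Poly_Mapping.keys e \<subseteq> Poly_Mapping.keys (a + b)" by (simp add: e(3) keys_add_nat)
  then have "{x, y} \<subseteq> U \<union> W" using Suc.prems(2,3) ke by (auto simp: keys_add_nat)
  then consider "{x, y} \<subseteq> U" | "{x, y} \<subseteq> W" using sep[OF xy(2)] by blast
  then show ?case
  proof cases
    case 1
    \<comment> \<open>On \<open>{x, y}\<close>, which lies in \<open>U\<close>, the vector
      \<open>b\<close> vanishes; elsewhere \<open>e\<close> does.\<close>
    have "poly_mapping.lookup e z \<le> poly_mapping.lookup a z" for z
      using le[of z] ke 1 assms(4) Suc.prems(3)
      by (metis add.right_neutral disjoint_iff in_keys_iff le0 subsetD)
    then have a: "a - e + e = a" by (rule exponent_diff_add)
    then have "(a - e) + b + e = c + e" using e(3) by (metis add.assoc add.commute)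
    then have "(a - e) + b = c" by simp
    moreover have "Poly_Mapping.keys (a - e) \<subseteq> U"
      using Suc.prems(2) a by (metis keys_add_nat le_sup_iff)
    ultimately obtain i j where "i + j = k" "a - e \<in> power_exponents E i" "b \<in> power_exponents E j"
      using Suc.IH[of "a - e" b] e(2) Suc.prems(3) by blast
    moreover from this have "a \<in> power_exponents E (i + 1)" using power_exponents_add e1 a by metis
    ultimately show ?thesis by (metis add_Suc Suc_eq_plus1)
  next
    case 2
    have "poly_mapping.lookup e z \<le> poly_mapping.lookup b z" for z
      using le[of z] ke 2 assms(4) Suc.prems(2)
      by (metis add_0 disjoint_iff in_keys_iff le0 subsetD)
    then have b: "b - e + e = b" by (rule exponent_diff_add)
    then have "a + (b - e) + e = c + e" using e(3) by (metis add.assoc)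
    then have "a + (b - e) = c" by simp
    moreover have "Poly_Mapping.keys (b - e) \<subseteq> W"
      using Suc.prems(3) b by (metis keys_add_nat le_sup_iff)
    ultimately obtain i j where "i + j = k" "a \<in> power_exponents E i" "b - e \<in> power_exponents E j"
      using Suc.IH[of a "b - e"] e(2) Suc.prems(2) by blast
    moreover from this have "b \<in> power_exponents E (j + 1)" using power_exponents_add e1 b by metis
    ultimately show ?thesis by (metis add_Suc_right Suc_eq_plus1)
  qed
qed simp

lemma edge_order_add:
  assumes "simple_graph V E"
    and "Poly_Mapping.keys a \<subseteq> U" "Poly_Mapping.keys b \<subseteq> W" "U \<inter> W = {}"
    and "\<And>e. e \<in> E \<Longrightarrow> e \<subseteq> U \<union> W \<Longrightarrow> e \<subseteq> U \<or> e \<subseteq> W"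
  shows "edge_order E (a + b) = edge_order E a + edge_order E b"
proof (rule antisym)
  note iff = le_edge_order_iff[OF assms(1)]
  have "a + b \<in> power_exponents E (edge_order E (a + b))" using iff by blast
  from power_exponents_add_split[OF this assms(2-5)]
  show "edge_order E (a + b) \<le> edge_order E a + edge_order E b"
    using iff by (metis add_mono)
  show "edge_order E a + edge_order E b \<le> edge_order E (a + b)"
    using iff power_exponents_add by blast
qed

text \<open>\<open>M\<close> is a union of fibres of the map that cuts every exponent off at \<open>N\<close>.\<close>

definition determined_up_to :: "nat \<Rightarrow> ('v \<Rightarrow>\<^sub>0 nat) set \<Rightarrow> bool" where
  "determined_up_to N M \<longleftrightarrow>
     (\<forall>a b. (\<forall>x. min (poly_mapping.lookup a x) N = min (poly_mapping.lookup b x) N)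
        \<longrightarrow> a \<in> M \<longrightarrow> b \<in> M)"

text \<open>Without loops an edge contributes at most 1 at each vertex. This is the origin of the
  cut-off.\<close>

lemma lookup_sum_mset_edge_monomials_le:
  assumes "simple_graph V E" "set_mset m \<subseteq> edge_monomials E"
  shows "poly_mapping.lookup (sum_mset m) x \<le> size m"
  using assms(2)
proof (induction m)
  case (add e m)
  then obtain u v where "e = Poly_Mapping.single u 1 + Poly_Mapping.single v 1" "{u, v} \<in> E"
    unfolding edge_monomials_def by auto
  moreover from this have "u \<noteq> v" using simple_graph_edgeD assms(1) by metis
  ultimately have "poly_mapping.lookup e x \<le> 1"
    by (auto simp: lookup_add lookup_single when_def)
  with add show ?case by (simp add: lookup_add)
qed simp

text \<open>The product of \<open>k\<close> edges dividing \<open>a\<close> has exponents at most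
  \<open>k \<le> N\<close>, so it still divides after any change of \<open>a\<close> that is
  invisible below \<open>N\<close>.\<close>

lemma power_exponents_determined:
  assumes "simple_graph V E" "k \<le> N"
  shows "determined_up_to N (power_exponents E k)"
  unfolding determined_up_to_def
proof (intro allI impI)
  fix a b :: "'a \<Rightarrow>\<^sub>0 nat"
  assume eq: "\<forall>x. min (poly_mapping.lookup a x) N = min (poly_mapping.lookup b x) N"
    and "a \<in> power_exponents E k"
  then obtain m r where m: "a = sum_mset m + r" "size m = k" "set_mset m \<subseteq> edge_monomials E"
    unfolding power_exponents_def by blast
  have "poly_mapping.lookup (sum_mset m) x \<le> poly_mapping.lookup b x" for x
  proof -
    have "poly_mapping.lookup (sum_mset m) x \<le> min (poly_mapping.lookup a x) N"
      using lookup_sum_mset_edge_monomials_le[OF assms(1) m(3), of x] m(2) assms(2)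
      by (simp add: m(1) lookup_add)
    then show ?thesis using eq by simp
  qed
  then have "b - sum_mset m + sum_mset m = b" by (rule exponent_diff_add)
  then have "b = sum_mset m + (b - sum_mset m)" by (metis add.commute)
  with m(2,3) show "b \<in> power_exponents E k" unfolding power_exponents_def by blast
qed

section \<open>Partitions into cones\<close>

definition stanley_cone :: "('v \<Rightarrow>\<^sub>0 nat) \<times> 'v set \<Rightarrow> ('v \<Rightarrow>\<^sub>0 nat) set" where
  "stanley_cone d = {fst d + v |v. Poly_Mapping.keys v \<subseteq> snd d}"

text \<open>The number \<open>n\<close> is a lower bound for the dimensions. Even for
  \<open>n = 0\<close> the statement has content, namely that finitely many cones suffice.\<close>

definition stanley_partition :: "'v set \<Rightarrow> ('v \<Rightarrow>\<^sub>0 nat) set \<Rightarrow> nat \<Rightarrow> bool" where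
  "stanley_partition V M n \<longleftrightarrow>
     (\<exists>D. finite D \<and> (\<forall>d\<in>D. snd d \<subseteq> V \<and> n \<le> card (snd d)) \<and>
          M = (\<Union>d\<in>D. stanley_cone d) \<and> disjoint_family_on stanley_cone D)"

lemma fst_in_stanley_cone: "fst d \<in> stanley_cone d"
  unfolding stanley_cone_def by (force intro: exI[of _ 0])

lemma stanley_cone_Un:
  assumes "S \<inter> T = {}"
  shows "stanley_cone (u + v, S \<union> T) = {a + b |a b. a \<in> stanley_cone (u, S) \<and> b \<in> stanley_cone (v, T)}"
    (is "?L = ?R")
proof
  show "?L \<subseteq> ?R"
  proof
    fix t assume "t \<in> ?L"
    then obtain w where w: "t = u + v + w" "Poly_Mapping.keys w \<subseteq> S \<union> T"
      unfolding stanley_cone_def by auto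
    have "t = (u + exponent_restrict S w) + (v + exponent_restrict T w)"
      using exponent_restrict_split[OF w(2) assms] w(1) by (metis add.assoc add.commute)
    then show "t \<in> ?R" unfolding stanley_cone_def by force
  qed
  show "?R \<subseteq> ?L"
  proof
    fix t assume "t \<in> ?R"
    then obtain a b where "t = u + a + (v + b)" "Poly_Mapping.keys a \<subseteq> S" "Poly_Mapping.keys b \<subseteq> T"
      unfolding stanley_cone_def by auto
    then have "t = u + v + (a + b)" "Poly_Mapping.keys (a + b) \<subseteq> S \<union> T"
      by (auto simp: keys_add_nat algebra_simps)
    then show "t \<in> ?L" unfolding stanley_cone_def by auto
  qed
qed

text \<open>Dimensions add because the direction sets of the two factors are disjoint. The product
  cones are disjoint because both summands can be recovered from their sum by restricting it to
  \<open>V\<close> and to \<open>W\<close>.\<close>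

lemma stanley_partition_product:
  assumes "finite V" "finite W" "V \<inter> W = {}"
    and M: "stanley_partition V M m" "\<And>a. a \<in> M \<Longrightarrow> Poly_Mapping.keys a \<subseteq> V"
    and L: "stanley_partition W L n" "\<And>b. b \<in> L \<Longrightarrow> Poly_Mapping.keys b \<subseteq> W"
  shows "stanley_partition (V \<union> W) {a + b |a b. a \<in> M \<and> b \<in> L} (m + n)"
proof -
  from M(1) obtain D where D: "finite D" "\<And>d. d \<in> D \<Longrightarrow> snd d \<subseteq> V \<and> m \<le> card (snd d)"
    "M = (\<Union>d\<in>D. stanley_cone d)" "disjoint_family_on stanley_cone D"
    unfolding stanley_partition_def by blast
  from L(1) obtain F where F: "finite F" "\<And>d. d \<in> F \<Longrightarrow> snd d \<subseteq> W \<and> n \<le> card (snd d)"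
    "L = (\<Union>d\<in>F. stanley_cone d)" "disjoint_family_on stanley_cone F"
    unfolding stanley_partition_def by blast
  define g where "g = (\<lambda>(d :: ('a \<Rightarrow>\<^sub>0 nat) \<times> 'a set, f :: ('a \<Rightarrow>\<^sub>0 nat) \<times> 'a set).
    (fst d + fst f, snd d \<union> snd f))"
  have cone: "stanley_cone (g (d, f)) = {a + b |a b. a \<in> stanley_cone d \<and> b \<in> stanley_cone f}"
    if "d \<in> D" "f \<in> F" for d f
  proof -
    have "snd d \<inter> snd f = {}" using D(2)[OF that(1)] F(2)[OF that(2)] assms(3) by blast
    then show ?thesis
      using stanley_cone_Un[of "snd d" "snd f" "fst d" "fst f"] by (simp add: g_def)
  qed
  have "disjoint_family_on stanley_cone (g ` (D \<times> F))"
    unfolding disjoint_family_on_def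
  proof (intro ballI impI, rule ccontr)
    fix p q assume "p \<in> g ` (D \<times> F)" "q \<in> g ` (D \<times> F)" "p \<noteq> q"
    then obtain d f d' f'
      where df: "p = g (d, f)" "q = g (d', f')" "d \<in> D" "f \<in> F" "d' \<in> D" "f' \<in> F"
      by auto
    assume "stanley_cone p \<inter> stanley_cone q \<noteq> {}"
    then obtain t where "t \<in> stanley_cone p" "t \<in> stanley_cone q" by blast
    then obtain a b a' b' where ab: "t = a + b" "a \<in> stanley_cone d" "b \<in> stanley_cone f"
      "t = a' + b'" "a' \<in> stanley_cone d'" "b' \<in> stanley_cone f'"
      unfolding df(1,2) cone[OF df(3,4)] cone[OF df(5,6)] by blast
    have "a + b = a' + b'" using ab by simp
    moreover have "a \<in> M" "a' \<in> M" "b \<in> L" "b' \<in> L" using ab df D(3) F(3) by blast+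
    ultimately have "a = a'" "b = b'"
      using exponent_add_inject[of a b a' b' V W] assms(3) M(2) L(2) by blast+
    then have "d = d'" "f = f'"
      using ab df D(4) F(4) unfolding disjoint_family_on_def by blast+
    then show False using \<open>p \<noteq> q\<close> df by simp
  qed
  moreover have "finite (g ` (D \<times> F))" using D(1) F(1) by simp
  moreover have "snd p \<subseteq> V \<union> W \<and> m + n \<le> card (snd p)" if p: "p \<in> g ` (D \<times> F)" for p
  proof -
    from p obtain d f where df: "p = g (d, f)" "d \<in> D" "f \<in> F" by auto
    have "snd d \<inter> snd f = {}" "finite (snd d)" "finite (snd f)"
      using D(2)[OF df(2)] F(2)[OF df(3)] assms(1-3) finite_subset by blast+
    then have "card (snd p) = card (snd d) + card (snd f)"
      by (simp add: df(1) g_def card_Un_disjoint)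
    then show ?thesis using D(2)[OF df(2)] F(2)[OF df(3)] by (auto simp: df(1) g_def)
  qed
  moreover have "{a + b |a b. a \<in> M \<and> b \<in> L} = (\<Union>p\<in>g ` (D \<times> F). stanley_cone p)"
  proof -
    have "{a + b |a b. a \<in> M \<and> b \<in> L} =
        (\<Union>(d, f)\<in>D \<times> F. {a + b |a b. a \<in> stanley_cone d \<and> b \<in> stanley_cone f})"
      unfolding D(3) F(3) by blast
    also have "\<dots> = (\<Union>(d, f)\<in>D \<times> F. stanley_cone (g (d, f)))"
      by (intro SUP_cong refl) (clarify, simp only: cone case_prod_conv)
    finally show ?thesis by (simp add: case_prod_unfold)
  qed
  ultimately show ?thesis unfolding stanley_partition_def
    by (intro exI[of _ "g ` (D \<times> F)"]) simp
qed

lemma stanley_partition_UN: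
  assumes "finite I" "\<And>i. i \<in> I \<Longrightarrow> stanley_partition V (M i) n" "disjoint_family_on M I"
  shows "stanley_partition V (\<Union>i\<in>I. M i) n"
proof -
  from assms(2) have "\<forall>i\<in>I. \<exists>D. finite D \<and> (\<forall>d\<in>D. snd d \<subseteq> V \<and> n \<le> card (snd d)) \<and>
          M i = (\<Union>d\<in>D. stanley_cone d) \<and> disjoint_family_on stanley_cone D"
    unfolding stanley_partition_def by blast
  then obtain D where D: "\<And>i. i \<in> I \<Longrightarrow> finite (D i)"
    "\<And>i d. i \<in> I \<Longrightarrow> d \<in> D i \<Longrightarrow> snd d \<subseteq> V \<and> n \<le> card (snd d)"
    "\<And>i. i \<in> I \<Longrightarrow> M i = (\<Union>d\<in>D i. stanley_cone d)"
    "\<And>i. i \<in> I \<Longrightarrow> disjoint_family_on stanley_cone (D i)"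
    by metis
  have "disjoint_family_on stanley_cone (\<Union>i\<in>I. D i)"
    unfolding disjoint_family_on_def
  proof (intro ballI impI)
    fix p q assume "p \<in> (\<Union>i\<in>I. D i)" "q \<in> (\<Union>i\<in>I. D i)" and ne: "p \<noteq> q"
    then obtain i j where ij: "i \<in> I" "p \<in> D i" "j \<in> I" "q \<in> D j" by blast
    show "stanley_cone p \<inter> stanley_cone q = {}"
    proof (cases "i = j")
      case True
      then show ?thesis using D(4)[OF ij(1)] ij ne unfolding disjoint_family_on_def by blast
    next
      case False
      then have "M i \<inter> M j = {}" using assms(3) ij unfolding disjoint_family_on_def by blast
      then show ?thesis using D(3) ij by blast
    qed
  qed
  moreover have "finite (\<Union>i\<in>I. D i)" using assms(1) D(1) by blast
  moreover have "(\<Union>i\<in>I. M i) = (\<Union>d\<in>(\<Union>i\<in>I. D i). stanley_cone d)" using D(3) by blast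
  ultimately show ?thesis unfolding stanley_partition_def
    using D(2) by (intro exI[of _ "\<Union>i\<in>I. D i"]) blast
qed

lemma stanley_partition_Un:
  assumes "stanley_partition V M n" "stanley_partition V L n" "M \<inter> L = {}"
  shows "stanley_partition V (M \<union> L) n"
proof -
  have "stanley_partition V (\<Union>i\<in>UNIV. if i then M else L) n"
    using assms by (intro stanley_partition_UN) (auto simp: disjoint_family_on_def)
  moreover have "(\<Union>i\<in>UNIV. if i then M else L) = M \<union> L" by (auto split: if_splits)
  ultimately show ?thesis by simp
qed

lemma finite_bounded_exponents:
  assumes "finite V"
  shows "finite {u :: 'v \<Rightarrow>\<^sub>0 nat. Poly_Mapping.keys u \<subseteq> V \<and> (\<forall>x. poly_mapping.lookup u x \<le> N)}"
    (is "finite ?B")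
proof (rule finite_imageD[of poly_mapping.lookup])
  have "poly_mapping.lookup ` ?B \<subseteq> {f. \<forall>x. (x \<in> V \<longrightarrow> f x \<in> {..N}) \<and> (x \<notin> V \<longrightarrow> f x = 0)}"
  proof clarify
    fix u :: "'v \<Rightarrow>\<^sub>0 nat" and x
    assume "Poly_Mapping.keys u \<subseteq> V" "\<forall>x. poly_mapping.lookup u x \<le> N"
    then show "(x \<in> V \<longrightarrow> poly_mapping.lookup u x \<in> {..N}) \<and> (x \<notin> V \<longrightarrow> poly_mapping.lookup u x = 0)"
      by (meson atMost_iff not_in_keys_iff_lookup_eq_zero subsetD)
  qed
  moreover have "finite {f. \<forall>x. (x \<in> V \<longrightarrow> f x \<in> {..N}) \<and> (x \<notin> V \<longrightarrow> f x = 0)}"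
    by (rule finite_set_of_finite_funs) (simp_all add: assms)
  ultimately show "finite (poly_mapping.lookup ` ?B)"
    by (rule finite_subset)
  show "inj_on poly_mapping.lookup ?B"
    by (intro inj_onI) (simp add: poly_mapping.lookup_inject)
qed

text \<open>The fibres of truncation at \<open>N\<close> are cones: the origin is the truncated
  vector, and the free directions are the coordinates where it has reached \<open>N\<close>. The
  origins are bounded by \<open>N\<close>, hence finite in number. An origin with all coordinates
  below \<open>N\<close> has no free direction, whence the bound 0.\<close>

lemma stanley_partition_determined:
  assumes "finite V" "\<And>a. a \<in> M \<Longrightarrow> Poly_Mapping.keys a \<subseteq> V"
    and det: "determined_up_to N M"
  shows "stanley_partition V M 0"
proof -
  define B where "B = {u \<in> M. \<forall>x. poly_mapping.lookup u x \<le> N}"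
  define Z where "Z u = {x \<in> V. poly_mapping.lookup u x = N}" for u :: "'a \<Rightarrow>\<^sub>0 nat"
  define D where "D = (\<lambda>u. (u, Z u)) ` B"
  have "finite B"
    by (rule finite_subset[OF _ finite_bounded_exponents[OF assms(1), of N]])
      (use assms(2) in \<open>auto simp: B_def\<close>)
  then have "finite D" by (simp add: D_def)
  have trunc: "min (poly_mapping.lookup (u + v) x) N = poly_mapping.lookup u x"
    if "u \<in> B" "Poly_Mapping.keys v \<subseteq> Z u" for u v x
  proof (cases "x \<in> Poly_Mapping.keys v")
    case True
    then show ?thesis using that by (auto simp: Z_def lookup_add)
  next
    case False
    then show ?thesis using that(1) by (auto simp: B_def lookup_add in_keys_iff)
  qed
  have disj: "disjoint_family_on stanley_cone D"
    unfolding disjoint_family_on_def D_def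
  proof (intro ballI impI, rule ccontr)
    fix p q assume "p \<in> (\<lambda>u. (u, Z u)) ` B" "q \<in> (\<lambda>u. (u, Z u)) ` B" "p \<noteq> q"
      and ne: "stanley_cone p \<inter> stanley_cone q \<noteq> {}"
    then obtain u u' where u: "p = (u, Z u)" "q = (u', Z u')" "u \<in> B" "u' \<in> B" by blast
    from ne obtain v v'
      where "u + v = u' + v'" "Poly_Mapping.keys v \<subseteq> Z u" "Poly_Mapping.keys v' \<subseteq> Z u'"
      unfolding u stanley_cone_def by auto
    then have "poly_mapping.lookup u x = poly_mapping.lookup u' x" for x
      using trunc[of u v x] trunc[of u' v' x] u by simp
    then have "u = u'" by (rule poly_mapping_eqI)
    then show False using \<open>p \<noteq> q\<close> u by simp
  qed
  have "M = (\<Union>d\<in>D. stanley_cone d)"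
  proof
    show "M \<subseteq> (\<Union>d\<in>D. stanley_cone d)"
    proof
      fix a assume a: "a \<in> M"
      define u where "u = Poly_Mapping.mapp (\<lambda>_ c. min c N) a"
      have lu: "poly_mapping.lookup u x = min (poly_mapping.lookup a x) N" for x
        by (auto simp: u_def lookup_mapp in_keys_iff when_def)
      have "u \<in> B"
        using det[unfolded determined_up_to_def, rule_format, of a u] a by (simp add: B_def lu)
      moreover have "a - u + u = a" by (rule exponent_diff_add) (simp add: lu)
      moreover have "Poly_Mapping.keys (a - u) \<subseteq> Z u"
        using assms(2)[OF a] by (auto simp: in_keys_iff lookup_minus lu Z_def split: if_splits)
      ultimately have "a \<in> stanley_cone (u, Z u)" unfolding stanley_cone_def
        by simp (metis add.commute)
      with \<open>u \<in> B\<close> show "a \<in> (\<Union>d\<in>D. stanley_cone d)" unfolding D_def by blast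
    qed
    show "(\<Union>d\<in>D. stanley_cone d) \<subseteq> M"
    proof
      fix a assume "a \<in> (\<Union>d\<in>D. stanley_cone d)"
      then obtain u v where u: "u \<in> B" "a = u + v" "Poly_Mapping.keys v \<subseteq> Z u"
        unfolding D_def stanley_cone_def by auto
      have "min (poly_mapping.lookup u x) N = min (poly_mapping.lookup a x) N" for x
        using trunc[OF u(1,3), of x] u(1,2) by (simp add: B_def)
      moreover have "u \<in> M" using u(1) by (simp add: B_def)
      ultimately show "a \<in> M" using det unfolding determined_up_to_def by blast
    qed
  qed
  with \<open>finite D\<close> disj show ?thesis
    unfolding stanley_partition_def by (intro exI[of _ D]) (auto simp: D_def Z_def)
qed

section \<open>Closure properties of sets determined by truncated exponents\<close>

lemma determined_up_to_shift:
  assumes "determined_up_to N M"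
  shows "determined_up_to N {a. a + b \<in> M}"
  unfolding determined_up_to_def
proof (intro allI impI CollectI)
  fix a a' :: "'a \<Rightarrow>\<^sub>0 nat"
  assume eq: "\<forall>x. min (poly_mapping.lookup a x) N = min (poly_mapping.lookup a' x) N"
    and "a \<in> {a. a + b \<in> M}"
  then have "a + b \<in> M" by simp
  moreover have "min (poly_mapping.lookup (a + b) x) N = min (poly_mapping.lookup (a' + b) x) N"
    for x
    using eq[rule_format, of x] by (auto simp: lookup_add min_def split: if_splits)
  ultimately show "a' + b \<in> M"
    using assms unfolding determined_up_to_def by blast
qed

lemma determined_up_to_Compl: "determined_up_to N (- M) \<longleftrightarrow> determined_up_to N M"
  unfolding determined_up_to_def Compl_iff by (intro iffI allI impI) metis+

text \<open>The index set may be infinite. Thus the condition that a whole ray stays inside a set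
  keeps the cut-off \<open>N\<close> of that set.\<close>

lemma determined_up_to_INT:
  "(\<And>i. i \<in> I \<Longrightarrow> determined_up_to N (M i)) \<Longrightarrow> determined_up_to N (\<Inter>i\<in>I. M i)"
  unfolding determined_up_to_def INT_iff by blast

lemma determined_up_to_Int:
  "determined_up_to N M \<Longrightarrow> determined_up_to N L \<Longrightarrow> determined_up_to N (M \<inter> L)"
  unfolding determined_up_to_def Int_iff by blast

lemma determined_up_to_Diff:
  "determined_up_to N M \<Longrightarrow> determined_up_to N L \<Longrightarrow> determined_up_to N (M - L)"
  by (simp add: Diff_eq determined_up_to_Int determined_up_to_Compl)

text \<open>Truncation at 0 identifies all vectors and hides the support; this is why
  \<open>stanley_partition_closed\<close> passes from \<open>N\<close> to
  \<open>Suc N\<close>.\<close>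

lemma determined_up_to_keys:
  assumes "0 < N" shows "determined_up_to N {a. Poly_Mapping.keys a \<subseteq> V}"
proof -
  have "min (m::nat) N = 0 \<longleftrightarrow> m = 0" for m using assms by auto
  then show ?thesis unfolding determined_up_to_def
    by (auto simp: subset_iff in_keys_iff) (metis neq0_conv)
qed

section \<open>Partitions into cones of positive dimension\<close>

lemma exponent_split_single:
  fixes c :: "'v \<Rightarrow>\<^sub>0 nat"
  shows "c = exponent_restrict (- {i}) c + Poly_Mapping.single i (poly_mapping.lookup c i)"
  by (rule poly_mapping_eqI) (simp add: lookup_add lookup_single when_def)

lemma stanley_partition_ray:
  "stanley_partition {i} {Poly_Mapping.single i n |n. t \<le> n} 1"
proof -
  have "stanley_cone (Poly_Mapping.single i t, {i}) = {Poly_Mapping.single i n |n. t \<le> n}"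
  proof (intro equalityI subsetI)
    fix c assume "c \<in> stanley_cone (Poly_Mapping.single i t, {i})"
    then obtain v where v: "c = Poly_Mapping.single i t + v" "Poly_Mapping.keys v \<subseteq> {i}"
      unfolding stanley_cone_def by auto
    have "v = Poly_Mapping.single i (poly_mapping.lookup v i)"
      by (rule poly_mapping_eqI)
        (use v(2) in \<open>auto simp: lookup_single when_def simp flip: not_in_keys_iff_lookup_eq_zero\<close>)
    then have "c = Poly_Mapping.single i (t + poly_mapping.lookup v i)"
      by (metis v(1) single_add)
    then show "c \<in> {Poly_Mapping.single i n |n. t \<le> n}" by auto
  next
    fix c assume "c \<in> {Poly_Mapping.single i n |n. t \<le> n}"
    then obtain n where "c = Poly_Mapping.single i (t + (n - t))" "t \<le> n" by auto
    then have "c = Poly_Mapping.single i t + Poly_Mapping.single i (n - t)"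
      by (simp only: single_add)
    then show "c \<in> stanley_cone (Poly_Mapping.single i t, {i})"
      unfolding stanley_cone_def by (auto intro!: exI[of _ "Poly_Mapping.single i (n - t)"])
  qed
  then show ?thesis unfolding stanley_partition_def
    by (intro exI[of _ "{(Poly_Mapping.single i t, {i})}"]) (simp add: disjoint_family_on_def)
qed

text \<open>Every line in direction \<open>i\<close> meets \<open>L\<close> in a ray or not at all.
  The lines are grouped by the starting value \<open>t\<close> of their ray: the base points
  \<open>Q t\<close> are cut into cones by truncation, and the factor \<open>R t\<close> supplies
  the one dimension.\<close>

lemma stanley_partition_closed:
  fixes L :: "('v \<Rightarrow>\<^sub>0 nat) set"
  assumes "finite V" "i \<in> V" "\<And>a. a \<in> L \<Longrightarrow> Poly_Mapping.keys a \<subseteq> V"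
    and det: "determined_up_to N L"
    and closed: "\<And>a n. a \<in> L \<Longrightarrow> a + Poly_Mapping.single i n \<in> L"
  shows "stanley_partition V L 1"
proof -
  let ?e = "Poly_Mapping.single i :: nat \<Rightarrow> 'v \<Rightarrow>\<^sub>0 nat"
  define Q where "Q t = {a. Poly_Mapping.keys a \<subseteq> V - {i} \<and> a + ?e t \<in> L \<and> (\<forall>s<t. a + ?e s \<notin> L)}"
    for t
  define R where "R t = {?e n |n. t \<le> n}" for t
  define P where "P t = {a + b |a b. a \<in> Q t \<and> b \<in> R t}" for t
  have keysR: "Poly_Mapping.keys b \<subseteq> {i}" if "b \<in> R t" for b t
    using that by (auto simp: R_def split: if_splits)
  have "stanley_partition V (P t) 1" for t
  proof -
    have "determined_up_to (Suc N) M" if "determined_up_to N M" for M :: "('v \<Rightarrow>\<^sub>0 nat) set"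
    proof -
      have "min x N = min y N" if "min x (Suc N) = min y (Suc N)" for x y :: nat
        using that by (auto simp: min_def split: if_splits)
      then show ?thesis using that unfolding determined_up_to_def by meson
    qed
    with det have det': "determined_up_to (Suc N) L" by blast
    have "Q t = {a. Poly_Mapping.keys a \<subseteq> V - {i}} \<inter> {a. a + ?e t \<in> L} \<inter> (\<Inter>s\<in>{..<t}. - {a. a + ?e s \<in> L})"
      by (auto simp: Q_def)
    also have "determined_up_to (Suc N) \<dots>"
      by (intro determined_up_to_Int determined_up_to_INT determined_up_to_shift
          determined_up_to_Compl[THEN iffD2] determined_up_to_keys det') simp
    finally have "stanley_partition (V - {i}) (Q t) 0"
      using assms(1) by (intro stanley_partition_determined) (auto simp: Q_def)
    from stanley_partition_product[OF _ _ _ this _ stanley_partition_ray[of i t]]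
    have "stanley_partition (V - {i} \<union> {i}) {a + b |a b. a \<in> Q t \<and> b \<in> R t} (0 + 1)"
      using assms(1) keysR unfolding R_def by (force simp: Q_def)
    then show ?thesis using assms(2) by (simp add: P_def insert_absorb)
  qed
  moreover have "disjoint_family_on P {..N}"
    unfolding disjoint_family_on_def
  proof (intro ballI impI, rule ccontr)
    fix t t' assume "t \<noteq> t'" "P t \<inter> P t' \<noteq> {}"
    then obtain a b a' b' where ab: "a + b = a' + b'" "a \<in> Q t" "b \<in> R t" "a' \<in> Q t'" "b' \<in> R t'"
      unfolding P_def by blast
    have "a = a'"
      by (rule exponent_add_inject(1)[OF ab(1), of "V - {i}" "{i}"])
        (use ab(2,4) keysR[OF ab(3)] keysR[OF ab(5)] in \<open>auto simp: Q_def\<close>)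
    with ab(2,4) have "\<not> t < t'" "\<not> t' < t" by (auto simp: Q_def)
    with \<open>t \<noteq> t'\<close> show False by simp
  qed
  moreover have "L = (\<Union>t\<in>{..N}. P t)"
  proof (intro equalityI subsetI)
    fix c assume c: "c \<in> L"
    define a where "a = exponent_restrict (- {i}) c"
    have ca: "c = a + ?e (poly_mapping.lookup c i)" unfolding a_def by (rule exponent_split_single)
    define t where "t = (LEAST t. a + ?e t \<in> L)"
    have tL: "a + ?e t \<in> L"
      unfolding t_def by (rule LeastI[of _ "poly_mapping.lookup c i"]) (use c ca in simp)
    have min: "s < t \<Longrightarrow> a + ?e s \<notin> L" for s unfolding t_def by (rule not_less_Least)
    have tc: "t \<le> poly_mapping.lookup c i" unfolding t_def by (rule Least_le) (use c ca in simp)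
    \<comment> \<open>If the ray started beyond \<open>N\<close>, lowering the \<open>i\<close>-th
      exponent of \<open>c\<close> to \<open>N\<close> would be invisible to the truncation and
      would give an earlier point of \<open>L\<close> on the same line.\<close>
    have "t \<le> N"
    proof (rule ccontr)
      assume "\<not> t \<le> N"
      then have "\<forall>x. min (poly_mapping.lookup c x) N = min (poly_mapping.lookup (a + ?e N) x) N"
        using tc by (auto simp: a_def lookup_add lookup_single when_def)
      with c det have "a + ?e N \<in> L" unfolding determined_up_to_def by blast
      with min[of N] \<open>\<not> t \<le> N\<close> show False by simp
    qed
    moreover have "a \<in> Q t" using assms(3)[OF c] tL min by (auto simp: Q_def a_def)
    moreover have "?e (poly_mapping.lookup c i) \<in> R t" using tc by (auto simp: R_def)
    ultimately show "c \<in> (\<Union>t\<in>{..N}. P t)" using ca unfolding P_def by blast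
  next
    fix c assume "c \<in> (\<Union>t\<in>{..N}. P t)"
    then obtain t a n where "a + ?e t \<in> L" "t \<le> n" "c = a + ?e n"
      unfolding P_def Q_def R_def by auto
    then show "c \<in> L" using closed[of "a + ?e t" "n - t"] by (simp add: add.assoc flip: single_add)
  qed
  ultimately show ?thesis using stanley_partition_UN[of "{..N}" V P 1] by simp
qed

text \<open>\<open>M\<close> is split according to the first direction in \<open>W\<close> in which a ray stays inside \<open>M\<close>;
  by convexity, removing the points of the first class does not destroy the rays of the others.\<close>

lemma stanley_partition_rays:
  fixes M :: "('v \<Rightarrow>\<^sub>0 nat) set"
  assumes "finite W" "W \<subseteq> V" "finite V" "\<And>a. a \<in> M \<Longrightarrow> Poly_Mapping.keys a \<subseteq> V"
    and "determined_up_to N M"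
    and "\<And>a b c. a \<in> M \<Longrightarrow> a + b + c \<in> M \<Longrightarrow> a + b \<in> M"
    and "\<And>a. a \<in> M \<Longrightarrow> \<exists>x\<in>W. \<forall>n. a + Poly_Mapping.single x n \<in> M"
  shows "stanley_partition V M 1"
  using assms
proof (induction W arbitrary: M rule: finite_induct)
  case empty
  then have "M = {}" by blast
  then show ?case unfolding stanley_partition_def
    by (intro exI[of _ "{}"]) (simp add: disjoint_family_on_def)
next
  case (insert i W)
  note convex = insert.prems(5)
  let ?e = "\<lambda>i. Poly_Mapping.single i :: nat \<Rightarrow> 'v \<Rightarrow>\<^sub>0 nat"
  define L where "L = {a \<in> M. \<forall>n. a + ?e i n \<in> M}"
  \<comment> \<open>Within \<open>M\<close>, the set \<open>L\<close> is closed downwards: a point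
    of the \<open>i\<close>-ray at \<open>a\<close> lies between \<open>a\<close> and the
    corresponding point of the \<open>i\<close>-ray at \<open>a + b\<close>, so convexity puts it
    into \<open>M\<close>.\<close>
  have mem_L: "a \<in> L" if "a \<in> M" "a + b \<in> L" for a b
  proof -
    have "a + ?e i n \<in> M" for n
    proof (rule convex[OF that(1), of _ b])
      have "a + b + ?e i n \<in> M" using that(2) unfolding L_def by blast
      then show "a + ?e i n + b \<in> M" by (simp only: ac_simps)
    qed
    then show ?thesis using that(1) unfolding L_def by blast
  qed
  have "L = M \<inter> (\<Inter>n\<in>UNIV. {a. a + ?e i n \<in> M})" by (auto simp: L_def)
  also have "determined_up_to N \<dots>"
    by (intro determined_up_to_Int determined_up_to_INT determined_up_to_shift insert.prems)
  finally have detL: "determined_up_to N L" .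
  have "a + ?e i n \<in> L" if "a \<in> L" for a n
    using that unfolding L_def by (simp add: add.assoc flip: single_add)
  then have "stanley_partition V L 1"
    using insert.prems(1-3) detL by (intro stanley_partition_closed[of V i L N]) (auto simp: L_def)
  moreover have "stanley_partition V (M - L) 1"
  proof (rule insert.IH)
    show "determined_up_to N (M - L)" using insert.prems(4) detL by (rule determined_up_to_Diff)
    show "a + b \<in> M - L" if "a \<in> M - L" "a + b + c \<in> M - L" for a b c
      using that convex[of a b c] mem_L by blast
    \<comment> \<open>The ray at \<open>a\<close> has a direction other than \<open>i\<close>, as
      \<open>a\<close> is not in \<open>L\<close>. It never enters \<open>L\<close>, for then
      \<open>mem_L\<close> would put \<open>a\<close> itself into \<open>L\<close>.\<close>
    show "\<exists>x\<in>W. \<forall>n. a + ?e x n \<in> M - L" if "a \<in> M - L" for a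
    proof -
      obtain x where x: "x \<in> insert i W" "\<forall>n. a + ?e x n \<in> M"
        using insert.prems(6) \<open>a \<in> M - L\<close> by blast
      moreover have "a + ?e x n \<notin> L" for n using mem_L \<open>a \<in> M - L\<close> by blast
      moreover have "x \<noteq> i" using x(2) \<open>a \<in> M - L\<close> unfolding L_def by blast
      ultimately show ?thesis by blast
    qed
  qed (use insert.prems in auto)
  ultimately have "stanley_partition V (L \<union> (M - L)) 1" by (rule stanley_partition_Un) blast
  moreover have "L \<union> (M - L) = M" by (auto simp: L_def)
  ultimately show ?case by simp
qed

section \<open>Level sets of the order\<close>

definition level_exponents :: "'v set \<Rightarrow> 'v set set \<Rightarrow> nat \<Rightarrow> ('v \<Rightarrow>\<^sub>0 nat) set" where
  "level_exponents U E k = {a. Poly_Mapping.keys a \<subseteq> U \<and> edge_order E a = k}"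

text \<open>Order \<open>k\<close> means membership for \<open>k\<close> edges but not for
  \<open>k + 1\<close>; both are visible at cut-off \<open>Suc k\<close>, which is also positive, as
  the support condition demands.\<close>

lemma level_exponents_determined:
  assumes "simple_graph V E"
  shows "determined_up_to (Suc k) (level_exponents U E k)"
proof -
  have "edge_order E a = k \<longleftrightarrow> a \<in> power_exponents E k \<and> a \<notin> power_exponents E (Suc k)" for a
    by (simp add: le_edge_order_iff[OF assms, symmetric]) linarith
  then have "level_exponents U E k =
      {a. Poly_Mapping.keys a \<subseteq> U} \<inter> (power_exponents E k - power_exponents E (Suc k))"
    unfolding level_exponents_def by blast
  also have "determined_up_to (Suc k) \<dots>"
    by (intro determined_up_to_Int determined_up_to_Diff determined_up_to_keys
        power_exponents_determined[OF assms]) simp_all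
  finally show ?thesis .
qed

text \<open>Edges whose product divides \<open>x^a\<close> lie in the support of \<open>a\<close>.
  So the order may be taken in the whole graph for every vertex set, while the Koenig theorem is
  applied to the induced subgraph.\<close>

lemma power_exponents_restrict_edges:
  assumes "a \<in> power_exponents E k" "Poly_Mapping.keys a \<subseteq> C"
  shows "a \<in> power_exponents {e \<in> E. e \<subseteq> C} k"
  using assms
proof (induction k arbitrary: a)
  case (Suc k)
  from Suc.prems(1) obtain e b where e: "e \<in> edge_monomials E" "b \<in> power_exponents E k" "a = b + e"
    by (rule power_exponents_Suc_split)
  from e(1) obtain x y
    where xy: "e = Poly_Mapping.single x 1 + Poly_Mapping.single y 1" "{x, y} \<in> E"
    unfolding edge_monomials_def by blast
  have keys: "Poly_Mapping.keys b \<subseteq> C" "{x, y} \<subseteq> C"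
    using Suc.prems(2) by (auto simp: e(3) xy(1) keys_add_nat)
  then have "e \<in> edge_monomials {e \<in> E. e \<subseteq> C}" using xy unfolding edge_monomials_def by blast
  then have "e \<in> power_exponents {e \<in> E. e \<subseteq> C} 1"
    using edge_monomials_subset_power_exponents by blast
  from power_exponents_add[OF Suc.IH[OF e(2) keys(1)] this] show ?case by (simp add: e(3))
qed simp

lemma bipartite_free_vertex:
  fixes a :: "'v \<Rightarrow>\<^sub>0 nat"
  assumes G: "simple_graph V E" and "C \<subseteq> V" "C \<noteq> {}" "bipartite_on E C" "Poly_Mapping.keys a \<subseteq> C"
  shows "\<exists>x\<in>C. \<forall>n. edge_order E (a + Poly_Mapping.single x n) = edge_order E a"
proof -
  let ?F = "{e \<in> E. e \<subseteq> C}" and ?k = "edge_order E a"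
  have finC: "finite C" using assms(1,2) finite_subset unfolding simple_graph_def by blast
  obtain X Y where XY: "C = X \<union> Y" "X \<inter> Y = {}" "\<forall>e\<in>?F. \<exists>x\<in>X. \<exists>y\<in>Y. e = {x, y}"
    using assms(4) unfolding bipartite_on_def by auto
  have "a \<notin> power_exponents E (Suc ?k)"
    using le_edge_order_iff[OF G, of "Suc ?k" a] by simp
  then have "a \<notin> power_exponents ?F (Suc ?k)" using power_exponents_mono[of ?F E] by blast
  then have "\<exists>K. K \<subseteq> X \<union> Y \<and> is_vertex_cover ?F K \<and> \<not> Suc ?k \<le> weight a K"
    using weighted_konig[of X Y ?F "Suc ?k" a] XY finC by auto
  then obtain K where K: "K \<subseteq> C" "is_vertex_cover ?F K" "weight a K \<le> ?k"
    unfolding XY(1) by (meson not_less_eq_eq)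
  have "\<exists>K z. K \<subseteq> C \<and> is_vertex_cover ?F K \<and> weight a K \<le> ?k \<and> z \<in> C - K"
  proof (cases "K = C")
    case True
    obtain z where z: "z \<in> C" using assms(3) by blast
    have "is_vertex_cover ?F (C - {z})"
      unfolding is_vertex_cover_def using XY(1-3) z by fastforce
    moreover have "weight a (C - {z}) \<le> weight a C" using finC by (intro weight_mono) auto
    ultimately show ?thesis using True K(3) z
      by (intro exI[of _ "C - {z}"] exI[of _ z]) auto
  next
    case False
    then show ?thesis using K by blast
  qed
  then obtain K z where K: "K \<subseteq> C" "is_vertex_cover ?F K" "weight a K \<le> ?k" "z \<in> C" "z \<notin> K" by blast
  have finK: "finite K" using K(1) finC finite_subset by blast
  have "edge_order E (a + Poly_Mapping.single z n) = ?k" for n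
  proof (rule antisym)
    let ?b = "a + Poly_Mapping.single z n"
    have "?b \<in> power_exponents E (edge_order E ?b)" using le_edge_order_iff[OF G] by blast
    then have "?b \<in> power_exponents ?F (edge_order E ?b)"
      using assms(5) K(4)
        by (intro power_exponents_restrict_edges) (auto simp: keys_add_nat split: if_splits)
    \<comment> \<open>Since \<open>z\<close> lies outside \<open>K\<close>, the cover has the same
      weight for \<open>?b\<close> as for \<open>a\<close> and bounds the order of \<open>?b\<close>
      by weak duality.\<close>
    from vertex_cover_weight_ge[OF K(2) finK this]
    show "edge_order E ?b \<le> ?k" using K(3,5) finK by (simp add: weight_add)
    show "?k \<le> edge_order E ?b" using edge_order_mono[OF G] .
  qed
  with K(4) show ?thesis by blast
qed

lemma stanley_partition_component:
  assumes G: "simple_graph V E" and "C \<subseteq> V" "C \<noteq> {}"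
  shows "stanley_partition C (level_exponents C E k) (if bipartite_on E C then 1 else 0)"
proof -
  note det = level_exponents_determined[OF G, of k C]
  have finC: "finite C" using assms(1,2) finite_subset unfolding simple_graph_def by blast
  have keys: "Poly_Mapping.keys a \<subseteq> C" if "a \<in> level_exponents C E k" for a
    using that unfolding level_exponents_def by blast
  show ?thesis
  proof (cases "bipartite_on E C")
    case True
    have "stanley_partition C (level_exponents C E k) 1"
    proof (rule stanley_partition_rays[OF finC subset_refl finC keys det])
      \<comment> \<open>Monotonicity squeezes the order of \<open>a + b\<close> between two values
        equal to \<open>k\<close>.\<close>
      show "a + b \<in> level_exponents C E k"
        if "a \<in> level_exponents C E k" "a + b + c \<in> level_exponents C E k" for a b c
        using that edge_order_mono[OF G, of a b] edge_order_mono[OF G, of "a + b" c]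
        unfolding level_exponents_def by (auto simp: keys_add_nat)
      show "\<exists>x\<in>C. \<forall>n. a + Poly_Mapping.single x n \<in> level_exponents C E k"
        if a: "a \<in> level_exponents C E k" for a
        using bipartite_free_vertex[OF assms True keys[OF a]] a
        unfolding level_exponents_def by (auto simp: keys_add_nat)
    qed
    then show ?thesis using True by simp
  next
    case False
    then show ?thesis using stanley_partition_determined[OF finC keys det] by simp
  qed
qed

text \<open>By additivity of the order, level \<open>k\<close> on the union consists of the products
  of level \<open>i\<close> on \<open>U\<close> and level \<open>k - i\<close> on \<open>W\<close>
  for \<open>i \<le> k\<close>. Partitions are therefore required at all levels. The pieces are
  disjoint because a vector determines its part on \<open>U\<close> and hence
  \<open>i\<close>.\<close>

lemma stanley_partition_level_Un:
  assumes G: "simple_graph V E" and sub: "U \<subseteq> V" "W \<subseteq> V" and disj: "U \<inter> W = {}"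
    and sep: "\<And>e. e \<in> E \<Longrightarrow> e \<subseteq> U \<union> W \<Longrightarrow> e \<subseteq> U \<or> e \<subseteq> W"
    and U: "\<And>k. stanley_partition U (level_exponents U E k) m"
    and W: "\<And>k. stanley_partition W (level_exponents W E k) n"
  shows "stanley_partition (U \<union> W) (level_exponents (U \<union> W) E k) (m + n)"
proof -
  define P where "P i = {a + b |a b. a \<in> level_exponents U E i \<and> b \<in> level_exponents W E (k - i)}"
    for i
  have fin: "finite U" "finite W"
    using G sub unfolding simple_graph_def by (auto intro: finite_subset)
  have order: "edge_order E (a + b) = edge_order E a + edge_order E b"
    if "Poly_Mapping.keys a \<subseteq> U" "Poly_Mapping.keys b \<subseteq> W" for a b
    using edge_order_add[OF G that disj] sep by blast
  have "stanley_partition (U \<union> W) (P i) (m + n)" for i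
    unfolding P_def using fin disj U W
    by (intro stanley_partition_product) (auto simp: level_exponents_def)
  moreover have "disjoint_family_on P {..k}"
    unfolding disjoint_family_on_def
  proof (intro ballI impI, rule ccontr)
    fix i j assume "i \<noteq> j" "P i \<inter> P j \<noteq> {}"
    then obtain a b a' b'
      where "a + b = a' + b'" "a \<in> level_exponents U E i" "b \<in> level_exponents W E (k - i)"
      "a' \<in> level_exponents U E j" "b' \<in> level_exponents W E (k - j)"
      unfolding P_def by blast
    moreover from this have "a = a'"
      by (intro exponent_add_inject(1)[of a b a' b' U W])
        (use disj in \<open>auto simp: level_exponents_def\<close>)
    ultimately show False using \<open>i \<noteq> j\<close> by (simp add: level_exponents_def)
  qed
  moreover have "level_exponents (U \<union> W) E k = (\<Union>i\<in>{..k}. P i)"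
  proof (intro equalityI subsetI)
    fix c assume c: "c \<in> level_exponents (U \<union> W) E k"
    then have split: "c = exponent_restrict U c + exponent_restrict W c"
      by (intro exponent_restrict_split disj) (simp add: level_exponents_def)
    have "k = edge_order E (exponent_restrict U c) + edge_order E (exponent_restrict W c)"
      using order[of "exponent_restrict U c" "exponent_restrict W c"] split c
      by (simp add: level_exponents_def)
    with split show "c \<in> (\<Union>i\<in>{..k}. P i)" unfolding P_def level_exponents_def
      by (intro UN_I[of "edge_order E (exponent_restrict U c)"] CollectI
          exI[of _ "exponent_restrict U c"] exI[of _ "exponent_restrict W c"]) auto
  next
    fix c assume "c \<in> (\<Union>i\<in>{..k}. P i)"
    then show "c \<in> level_exponents (U \<union> W) E k"
      unfolding P_def level_exponents_def by (auto simp: order keys_add_nat)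
  qed
  ultimately show ?thesis using stanley_partition_UN[of "{..k}" "U \<union> W" P "m + n"] by simp
qed

section \<open>Assembling the connected components\<close>

lemma graph_components_partition:
  assumes "simple_graph V E"
  shows "finite (graph_components V E)"
    and "\<And>C. C \<in> graph_components V E \<Longrightarrow> C \<subseteq> V \<and> C \<noteq> {}"
    and "\<And>C D. C \<in> graph_components V E \<Longrightarrow> D \<in> graph_components V E \<Longrightarrow> C \<noteq> D \<Longrightarrow> C \<inter> D = {}"
    and "\<And>e. e \<in> E \<Longrightarrow> \<exists>C\<in>graph_components V E. e \<subseteq> C"
    and "\<Union> (graph_components V E) = V"
proof -
  define S where "S = {(x, y). {x, y} \<in> E}"
  define R where "R = {(u, v) \<in> V \<times> V. (u, v) \<in> S\<^sup>*}"
  have comps: "graph_components V E = V // R"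
    unfolding graph_components_def R_def S_def by simp
  have "sym S" by (auto simp: S_def sym_def insert_commute)
  then have "sym (S\<^sup>*)" by (rule sym_rtrancl)
  then have R: "equiv V R"
    unfolding R_def by (intro equivI refl_onI symI transI) (auto dest: symD)
  show "finite (graph_components V E)"
    unfolding comps using assms by (intro finite_quotient[of V]) (auto simp: simple_graph_def R_def)
  show "C \<subseteq> V \<and> C \<noteq> {}" if "C \<in> graph_components V E" for C
    using that R in_quotient_imp_non_empty in_quotient_imp_subset unfolding comps by metis
  show "C \<inter> D = {}" if "C \<in> graph_components V E" "D \<in> graph_components V E" "C \<noteq> D" for C D
    using quotient_disj[OF R] that unfolding comps by blast
  show "\<Union> (graph_components V E) = V" unfolding comps by (rule Union_quotient[OF R])
  show "\<exists>C\<in>graph_components V E. e \<subseteq> C" if e: "e \<in> E" for e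
  proof -
    from e assms obtain x y where xy: "e = {x, y}"
      unfolding simple_graph_def by (auto simp: card_2_iff)
    then have "x \<in> V" "y \<in> V" using simple_graph_edgeD[OF assms, of x y] e by auto
    then have "(x, y) \<in> R" "(x, x) \<in> R" using e xy by (auto simp: R_def S_def)
    then have "e \<subseteq> R `` {x}" using xy by auto
    moreover have "R `` {x} \<in> graph_components V E" unfolding comps
      using \<open>x \<in> V\<close> by (rule quotientI)
    ultimately show ?thesis by blast
  qed
qed

lemma stanley_partition_level_exponents:
  assumes G: "simple_graph V E"
  shows "stanley_partition V (level_exponents V E k) (card {C \<in> graph_components V E. bipartite_on E C})"
proof -
  note comp = graph_components_partition[OF G]
  \<comment> \<open>The induction runs over sets \<open>\<D>\<close> of components with
    \<open>k\<close> left free, since adding a component draws on all levels up to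
    \<open>k\<close>.\<close>
  have "stanley_partition (\<Union>\<D>) (level_exponents (\<Union>\<D>) E k) (card {C \<in> \<D>. bipartite_on E C})"
    if "\<D> \<subseteq> graph_components V E" for \<D> k
    using finite_subset[OF that comp(1)] that
  proof (induction \<D> arbitrary: k rule: finite_induct)
    case empty
    have "stanley_partition {} (level_exponents {} E k) 0"
      using level_exponents_determined[OF G, of k "{}"]
      by (intro stanley_partition_determined) (auto simp: level_exponents_def)
    then show ?case by simp
  next
    case (insert C \<D>)
    have disj: "C \<inter> \<Union>\<D> = {}" using insert comp(3)[of C] by blast
    \<comment> \<open>The edge lies in a single component of the graph. Being nonempty, it meets a
      member of \<open>insert C \<D>\<close>, which must be that component.\<close>
    have sep: "e \<subseteq> C \<or> e \<subseteq> \<Union>\<D>" if e: "e \<in> E" "e \<subseteq> C \<union> \<Union>\<D>" for e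
    proof -
      obtain C' where C': "C' \<in> graph_components V E" "e \<subseteq> C'" using comp(4)[OF e(1)] by blast
      have "e \<noteq> {}" using e(1) G unfolding simple_graph_def by auto
      then obtain x where "x \<in> e" by blast
      then obtain D where "D \<in> insert C \<D>" "x \<in> D" using e(2) by blast
      moreover from this have "D = C'" using comp(3)[of D C'] C' insert.prems \<open>x \<in> e\<close> by blast
      ultimately show ?thesis using C'(2) by blast
    qed
    have "stanley_partition (C \<union> \<Union>\<D>) (level_exponents (C \<union> \<Union>\<D>) E k)
        ((if bipartite_on E C then 1 else 0) + card {C \<in> \<D>. bipartite_on E C})"
    proof (rule stanley_partition_level_Un[OF G _ _ disj sep])
      show "C \<subseteq> V" "\<Union>\<D> \<subseteq> V" using comp(2) insert.prems by blast+
      show "stanley_partition C (level_exponents C E k) (if bipartite_on E C then 1 else 0)" for k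
        using comp(2)[of C] insert.prems by (intro stanley_partition_component[OF G]) auto
      show "stanley_partition (\<Union>\<D>) (level_exponents (\<Union>\<D>) E k) (card {C \<in> \<D>. bipartite_on E C})"
        for k
        using insert.IH insert.prems by blast
    qed
    moreover have "{D \<in> insert C \<D>. bipartite_on E D} =
        (if bipartite_on E C then insert C {D \<in> \<D>. bipartite_on E D} else {D \<in> \<D>. bipartite_on E D})"
      by auto
    moreover from this have "card {D \<in> insert C \<D>. bipartite_on E D} =
        (if bipartite_on E C then 1 else 0) + card {C \<in> \<D>. bipartite_on E C}"
      using insert.hyps by (simp only:) simp
    ultimately show ?case by (simp only: Union_insert)
  qed
  from this[of "graph_components V E" k] show ?thesis using comp(5) by simp
qed

section \<open>Monomial ideals and Stanley decompositions\<close>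

lemma carrier_mpoly_ring_iff:
  "f \<in> carrier (mpoly_ring Z) \<longleftrightarrow> (\<forall>t\<in>Poly_Mapping.keys f. Poly_Mapping.keys t \<subseteq> Z)"
  by (simp add: mpoly_ring_def)

lemma mpoly_ring_simps [simp]:
  "monoid.mult (mpoly_ring Z) = (*)" "one (mpoly_ring Z) = 1" "zero (mpoly_ring Z) = 0"
    "add (mpoly_ring Z) = (+)"
  by (simp_all add: mpoly_ring_def)

lemma mpoly_ring_mono: "Z \<subseteq> V \<Longrightarrow> carrier (mpoly_ring Z) \<subseteq> carrier (mpoly_ring V)"
  by (auto simp: mpoly_ring_def)

lemma mpoly_ring_add_closed:
  "f \<in> carrier (mpoly_ring Z) \<Longrightarrow> g \<in> carrier (mpoly_ring Z) \<Longrightarrow> f + g \<in> carrier (mpoly_ring Z)"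
  using Poly_Mapping.keys_add[of f g] unfolding carrier_mpoly_ring_iff by blast

lemma mpoly_ring_uminus_closed: "f \<in> carrier (mpoly_ring Z) \<Longrightarrow> - f \<in> carrier (mpoly_ring Z)"
  by (auto simp: carrier_mpoly_ring_iff in_keys_iff)

lemma mpoly_ring_mult_closed:
  assumes "f \<in> carrier (mpoly_ring Z)" "g \<in> carrier (mpoly_ring Z)"
  shows "f * g \<in> carrier (mpoly_ring Z)"
  unfolding carrier_mpoly_ring_iff
proof
  fix t assume "t \<in> Poly_Mapping.keys (f * g)"
  then obtain a b where "t = a + b" "a \<in> Poly_Mapping.keys f" "b \<in> Poly_Mapping.keys g"
    using keys_mult[of f g] by blast
  then show "Poly_Mapping.keys t \<subseteq> Z"
    using assms unfolding carrier_mpoly_ring_iff by (auto simp: keys_add_nat)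
qed

lemma mpoly_ring_zero_one_closed:
  "0 \<in> carrier (mpoly_ring Z)" "1 \<in> carrier (mpoly_ring Z)"
  by (simp_all add: carrier_mpoly_ring_iff)

lemma cring_mpoly_ring: "cring (mpoly_ring Z)"
proof (intro cringI abelian_groupI comm_monoidI)
  show "\<exists>g\<in>carrier (mpoly_ring Z). g \<oplus>\<^bsub>mpoly_ring Z\<^esub> f = \<zero>\<^bsub>mpoly_ring Z\<^esub>"
    if "f \<in> carrier (mpoly_ring Z)" for f :: "('a, 'b) mpoly"
    using mpoly_ring_uminus_closed[OF that] by (intro bexI[of _ "- f"]) simp_all
qed (simp_all add: mpoly_ring_add_closed mpoly_ring_mult_closed mpoly_ring_zero_one_closed algebra_simps)

lemma poly_eq_sum_monomials:
  fixes f :: "'a \<Rightarrow>\<^sub>0 'b::comm_monoid_add"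
  shows "f = (\<Sum>t\<in>Poly_Mapping.keys f. Poly_Mapping.single t (poly_mapping.lookup f t))"
proof (rule poly_mapping_eqI)
  fix s
  have "poly_mapping.lookup (\<Sum>t\<in>Poly_Mapping.keys f. Poly_Mapping.single t (poly_mapping.lookup f t)) s =
      (\<Sum>t\<in>Poly_Mapping.keys f. if s = t then poly_mapping.lookup f t else 0)"
    unfolding lookup_sum by (rule sum.cong) (auto simp: lookup_single when_def)
  also have "\<dots> = poly_mapping.lookup f s"
    by (simp add: sum.delta not_in_keys_iff_lookup_eq_zero)
  finally show "poly_mapping.lookup f s =
      poly_mapping.lookup (\<Sum>t\<in>Poly_Mapping.keys f. Poly_Mapping.single t (poly_mapping.lookup f t)) s"
    by simp
qed

lemma mem_if_monomials_mem:
  fixes f :: "'a \<Rightarrow>\<^sub>0 'b::comm_monoid_add"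
  assumes "0 \<in> S" "\<And>g h. g \<in> S \<Longrightarrow> h \<in> S \<Longrightarrow> g + h \<in> S"
    and "\<And>t c. t \<in> Poly_Mapping.keys f \<Longrightarrow> Poly_Mapping.single t c \<in> S"
  shows "f \<in> S"
proof -
  have "(\<Sum>t\<in>T. Poly_Mapping.single t (poly_mapping.lookup f t)) \<in> S"
    if "finite T" "T \<subseteq> Poly_Mapping.keys f" for T
    using that by (induction T rule: finite_induct) (simp_all add: assms)
  then show ?thesis
    using poly_eq_sum_monomials[of f] finite_keys[of f] by (metis order_refl)
qed

text \<open>Multiplication by a monomial loses no coefficient; its injectivity will give the
  freeness of Stanley spaces.\<close>

lemma lookup_mult_monomial:
  fixes f :: "'a::cancel_comm_monoid_add \<Rightarrow>\<^sub>0 'b::comm_semiring_1"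
  shows "poly_mapping.lookup (f * Poly_Mapping.single u 1) (t + u) = poly_mapping.lookup f t"
proof -
  have "f * Poly_Mapping.single u 1 =
      (\<Sum>s\<in>Poly_Mapping.keys f. Poly_Mapping.single (s + u) (poly_mapping.lookup f s))"
    by (subst poly_eq_sum_monomials[of f]) (simp add: sum_distrib_right mult_single)
  then have "poly_mapping.lookup (f * Poly_Mapping.single u 1) (t + u) =
      (\<Sum>s\<in>Poly_Mapping.keys f.
        poly_mapping.lookup (Poly_Mapping.single (s + u) (poly_mapping.lookup f s)) (t + u))"
    by (simp only: lookup_sum)
  also have "\<dots> = (\<Sum>s\<in>Poly_Mapping.keys f. if t = s then poly_mapping.lookup f s else 0)"
    by (rule sum.cong) (auto simp: lookup_single when_def)
  also have "\<dots> = poly_mapping.lookup f t"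
    by (simp add: sum.delta not_in_keys_iff_lookup_eq_zero)
  finally show ?thesis .
qed

text \<open>The bridge from combinatorics to algebra: the linear span of the monomials in a cone is
  \<open>x^u K[Z]\<close>.\<close>

lemma keys_subset_stanley_cone_iff:
  fixes f :: "('v, 'k::field) mpoly"
  shows "Poly_Mapping.keys f \<subseteq> stanley_cone d \<longleftrightarrow>
    (\<exists>v\<in>carrier (mpoly_ring (snd d)). f = v * Poly_Mapping.single (fst d) 1)"
proof
  let ?S = "{f. \<exists>v\<in>carrier (mpoly_ring (snd d)). f = v * Poly_Mapping.single (fst d) (1::'k)}"
  assume sub: "Poly_Mapping.keys f \<subseteq> stanley_cone d"
  have "f \<in> ?S"
  proof (rule mem_if_monomials_mem)
    show "0 \<in> ?S" using mpoly_ring_zero_one_closed(1) by force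
    show "g + h \<in> ?S" if "g \<in> ?S" "h \<in> ?S" for g h
    proof -
      from that obtain v w
        where "v \<in> carrier (mpoly_ring (snd d))" "w \<in> carrier (mpoly_ring (snd d))"
        "g + h = (v + w) * Poly_Mapping.single (fst d) 1"
        by (auto simp: distrib_right)
      then show ?thesis using mpoly_ring_add_closed by blast
    qed
    show "Poly_Mapping.single t c \<in> ?S" if "t \<in> Poly_Mapping.keys f" for t c
    proof -
      obtain w where w: "t = w + fst d" "Poly_Mapping.keys w \<subseteq> snd d"
        using sub \<open>t \<in> Poly_Mapping.keys f\<close> unfolding stanley_cone_def by (auto simp: add.commute)
      then have "Poly_Mapping.single t c = Poly_Mapping.single w c * Poly_Mapping.single (fst d) 1"
        by (simp add: mult_single)
      moreover have "Poly_Mapping.single w c \<in> carrier (mpoly_ring (snd d))"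
        using w(2) by (simp add: carrier_mpoly_ring_iff)
      ultimately show ?thesis by blast
    qed
  qed
  then show "\<exists>v\<in>carrier (mpoly_ring (snd d)). f = v * Poly_Mapping.single (fst d) 1" by blast
next
  assume "\<exists>v\<in>carrier (mpoly_ring (snd d)). f = v * Poly_Mapping.single (fst d) 1"
  then obtain v where v: "v \<in> carrier (mpoly_ring (snd d))" "f = v * Poly_Mapping.single (fst d) 1"
    by blast
  show "Poly_Mapping.keys f \<subseteq> stanley_cone d"
  proof
    fix t assume "t \<in> Poly_Mapping.keys f"
    then obtain w where "t = w + fst d" "w \<in> Poly_Mapping.keys v"
      using keys_mult[of v "Poly_Mapping.single (fst d) 1"] v(2) by auto
    then show "t \<in> stanley_cone d"
      using v(1) unfolding stanley_cone_def carrier_mpoly_ring_iff by (auto simp: add.commute)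
  qed
qed

section \<open>Monomial ideals and the powers of the edge ideal\<close>

definition monomial_ideal :: "'v set \<Rightarrow> ('v \<Rightarrow>\<^sub>0 nat) set \<Rightarrow> ('v, 'k::field) mpoly set" where
  "monomial_ideal V A = {f \<in> carrier (mpoly_ring V). Poly_Mapping.keys f \<subseteq> A}"

lemma ideal_monomial_ideal:
  assumes "\<And>a b. a \<in> A \<Longrightarrow> a + b \<in> A"
  shows "ideal (monomial_ideal V A) (mpoly_ring V)"
proof -
  interpret cring "mpoly_ring V" by (rule cring_mpoly_ring)
  have uminus: "\<ominus>\<^bsub>mpoly_ring V\<^esub> f = - f" if "f \<in> carrier (mpoly_ring V)" for f
    using that mpoly_ring_uminus_closed by (intro minus_equality) simp_all
  have mult: "f * g \<in> monomial_ideal V A"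
    if "f \<in> monomial_ideal V A" "g \<in> carrier (mpoly_ring V)" for f g
  proof -
    have "Poly_Mapping.keys (f * g) \<subseteq> A"
      using keys_mult[of f g] that(1) assms unfolding monomial_ideal_def by blast
    then show ?thesis using that mpoly_ring_mult_closed unfolding monomial_ideal_def by blast
  qed
  show ?thesis
  proof (rule idealI)
    show "subgroup (monomial_ideal V A) (add_monoid (mpoly_ring V))"
    proof (rule add.subgroupI)
      show "monomial_ideal V A \<noteq> {}"
        using mpoly_ring_zero_one_closed(1) by (force simp: monomial_ideal_def)
      show "\<ominus>\<^bsub>mpoly_ring V\<^esub> f \<in> monomial_ideal V A" if "f \<in> monomial_ideal V A" for f
        using that mpoly_ring_uminus_closed by (auto simp: monomial_ideal_def uminus in_keys_iff)
      show "f \<oplus>\<^bsub>mpoly_ring V\<^esub> g \<in> monomial_ideal V A"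
        if "f \<in> monomial_ideal V A" "g \<in> monomial_ideal V A" for f g
        using that mpoly_ring_add_closed Poly_Mapping.keys_add[of f g]
        by (auto simp: monomial_ideal_def)
    qed (auto simp: monomial_ideal_def)
    show "g \<otimes>\<^bsub>mpoly_ring V\<^esub> f \<in> monomial_ideal V A" "f \<otimes>\<^bsub>mpoly_ring V\<^esub> g \<in> monomial_ideal V A"
      if "f \<in> monomial_ideal V A" "g \<in> carrier (mpoly_ring V)" for f g
      using mult[OF that] by (simp_all add: mult.commute)
  qed (rule ring_axioms)
qed

lemma monomial_ideal_add:
  "f \<in> monomial_ideal V A \<Longrightarrow> g \<in> monomial_ideal V A \<Longrightarrow> f + g \<in> monomial_ideal V A"
  using Poly_Mapping.keys_add[of f g] mpoly_ring_add_closed unfolding monomial_ideal_def by blast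

lemma zero_in_monomial_ideal: "0 \<in> monomial_ideal V A"
  by (simp add: monomial_ideal_def mpoly_ring_zero_one_closed)

lemma single_in_monomial_ideal:
  "Poly_Mapping.keys t \<subseteq> V \<Longrightarrow> t \<in> A \<Longrightarrow> Poly_Mapping.single t c \<in> monomial_ideal V A"
  by (simp add: monomial_ideal_def carrier_mpoly_ring_iff)

lemma mpoly_var_mult:
  "mpoly_var x * mpoly_var y = Poly_Mapping.single (Poly_Mapping.single x 1 + Poly_Mapping.single y 1) 1"
  by (simp add: mpoly_var_def mult_single)

lemma edge_ideal_eq:
  assumes "simple_graph V E"
  shows "edge_ideal V E = (monomial_ideal V (power_exponents E 1) :: ('v, 'k::field) mpoly set)"
proof -
  let ?G = "{mpoly_var x * mpoly_var y |x y. {x, y} \<in> E} :: ('v, 'k) mpoly set"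
  let ?R = "mpoly_ring V :: ('v, 'k) mpoly ring"
  have G_iff: "g \<in> ?G \<longleftrightarrow> (\<exists>e\<in>edge_monomials E. g = Poly_Mapping.single e 1)" for g
    unfolding edge_monomials_def mpoly_var_mult by blast
  have keys: "Poly_Mapping.keys e \<subseteq> V" if "e \<in> edge_monomials E" for e
    using that simple_graph_edgeD[OF assms]
      unfolding edge_monomials_def by (auto simp: keys_add_nat)
  show ?thesis
  proof
    have "?G \<subseteq> monomial_ideal V (power_exponents E 1)"
      using keys edge_monomials_subset_power_exponents[of E] single_in_monomial_ideal
      by (intro subsetI) (auto simp only: G_iff intro!: single_in_monomial_ideal)
    then show "edge_ideal V E \<subseteq> (monomial_ideal V (power_exponents E 1) :: ('v, 'k) mpoly set)"
      unfolding edge_ideal_def genideal_def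
      using ideal_monomial_ideal[of "power_exponents E 1" V] power_exponents_add_right by blast
    show "(monomial_ideal V (power_exponents E 1) :: ('v, 'k) mpoly set) \<subseteq> edge_ideal V E"
      unfolding edge_ideal_def genideal_def
    proof (intro subsetI InterI)
      fix f :: "('v, 'k) mpoly" and H
      assume f: "f \<in> monomial_ideal V (power_exponents E 1)" and "H \<in> {I. ideal I ?R \<and> ?G \<subseteq> I}"
      then have H: "ideal H ?R" "?G \<subseteq> H" by auto
      interpret ideal H ?R by (rule H(1))
      show "f \<in> H"
      proof (rule mem_if_monomials_mem)
        show "0 \<in> H" using additive_subgroup.zero_closed[OF is_additive_subgroup] by simp
        show "g + h \<in> H" if "g \<in> H" "h \<in> H" for g h
          using additive_subgroup.a_closed[OF is_additive_subgroup that] by simp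
        fix t c assume "t \<in> Poly_Mapping.keys f"
        then have t: "Poly_Mapping.keys t \<subseteq> V" "t \<in> power_exponents E 1"
          using f unfolding monomial_ideal_def carrier_mpoly_ring_iff by blast+
        from t(2) obtain e b where e: "e \<in> edge_monomials E" "t = b + e"
          using power_exponents_Suc_split[of t E 0] by (metis One_nat_def)
        then have "Poly_Mapping.single e 1 \<in> H" using H(2) G_iff by blast
        moreover have "Poly_Mapping.single b c \<in> carrier ?R"
          using t(1) by (simp add: carrier_mpoly_ring_iff e(2) keys_add_nat)
        ultimately have "Poly_Mapping.single b c * Poly_Mapping.single e 1 \<in> H"
          using I_l_closed by fastforce
        then show "Poly_Mapping.single t c \<in> H" by (simp add: mult_single e(2))
      qed
    qed
  qed
qed

text \<open>The power is unfolded as the product of the \<open>k\<close>-th power with the ideal.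
  Supports of products add up, and conversely a monomial divisible by \<open>k + 1\<close> edges is
  one divisible by \<open>k\<close> edges times an edge.\<close>

lemma ideal_power_edge_ideal:
  assumes "simple_graph V E"
  shows "ideal_power (mpoly_ring V) (edge_ideal V E) k =
    (monomial_ideal V (power_exponents E k) :: ('v, 'k::field) mpoly set)"
proof (induction k)
  case 0
  show ?case by (simp add: ideal_power_def ideals_set_def monomial_ideal_def)
next
  case (Suc k)
  let ?R = "mpoly_ring V :: ('v, 'k) mpoly ring"
  let ?I = "\<lambda>k. monomial_ideal V (power_exponents E k) :: ('v, 'k) mpoly set"
  have "ideal_power ?R (edge_ideal V E) (Suc k) = ideal_prod ?R (?I k) (?I 1)"
    using Suc by (simp add: ideal_power_def ideals_set_def edge_ideal_eq[OF assms])
  also have "\<dots> = ?I (Suc k)"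
  proof (intro equalityI subsetI)
    fix f assume "f \<in> ideal_prod ?R (?I k) (?I 1)"
    then show "f \<in> ?I (Suc k)"
    proof (induction rule: ideal_prod.induct)
      case (prod g h)
      have "t \<in> power_exponents E (Suc k)" if t: "t \<in> Poly_Mapping.keys (g * h)" for t
      proof -
        obtain a b where "t = a + b" "a \<in> Poly_Mapping.keys g" "b \<in> Poly_Mapping.keys h"
          using keys_mult[of g h] t by blast
        then show ?thesis
          using prod power_exponents_add[of a E k b 1] unfolding monomial_ideal_def by auto
      qed
      then show ?case using prod mpoly_ring_mult_closed unfolding monomial_ideal_def by auto
    next
      case (sum g h)
      then show ?case using monomial_ideal_add by simp
    qed
  next
    fix f assume f: "f \<in> ?I (Suc k)"
    show "f \<in> ideal_prod ?R (?I k) (?I 1)"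
    proof (rule mem_if_monomials_mem)
      show "0 \<in> ideal_prod ?R (?I k) (?I 1)"
        using ideal_prod.prod[OF zero_in_monomial_ideal zero_in_monomial_ideal, of ?R V _ V] by simp
      show "g + h \<in> ideal_prod ?R (?I k) (?I 1)"
        if "g \<in> ideal_prod ?R (?I k) (?I 1)" "h \<in> ideal_prod ?R (?I k) (?I 1)" for g h
        using ideal_prod.sum[OF that] by simp
      fix t c assume "t \<in> Poly_Mapping.keys f"
      then have t: "Poly_Mapping.keys t \<subseteq> V" "t \<in> power_exponents E (Suc k)"
        using f unfolding monomial_ideal_def carrier_mpoly_ring_iff by blast+
      from t(2) obtain e b where e: "e \<in> edge_monomials E" "b \<in> power_exponents E k" "t = b + e"
        by (rule power_exponents_Suc_split)
      have "Poly_Mapping.keys b \<subseteq> V" "Poly_Mapping.keys e \<subseteq> V"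
        using t(1) by (auto simp: e(3) keys_add_nat)
      moreover have "e \<in> power_exponents E 1"
        using e(1) edge_monomials_subset_power_exponents by blast
      ultimately have "Poly_Mapping.single b c \<in> ?I k" "Poly_Mapping.single e 1 \<in> ?I 1"
        using e(2) by (simp_all only: single_in_monomial_ideal)
      from ideal_prod.prod[OF this, of ?R]
      show "Poly_Mapping.single t c \<in> ideal_prod ?R (?I k) (?I 1)"
        by (simp add: mult_single e(3))
    qed
  qed
  finally show ?case .
qed

section \<open>Quotients of monomial ideals\<close>

lemma sum_exponent_restrict:
  assumes "finite D" "disjoint_family_on S D"
  shows "(\<Sum>d\<in>D. exponent_restrict (S d) f) = exponent_restrict (\<Union>d\<in>D. S d) (f :: 'a \<Rightarrow>\<^sub>0 'b::comm_monoid_add)"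
proof (rule poly_mapping_eqI)
  fix t
  show "poly_mapping.lookup (\<Sum>d\<in>D. exponent_restrict (S d) f) t =
      poly_mapping.lookup (exponent_restrict (\<Union>d\<in>D. S d) f) t"
  proof (cases "t \<in> (\<Union>d\<in>D. S d)")
    case True
    then obtain d where d: "d \<in> D" "t \<in> S d" by blast
    then have "t \<in> S d' \<longleftrightarrow> d' = d" if "d' \<in> D" for d'
      using assms(2) that unfolding disjoint_family_on_def by blast
    then have "(\<Sum>d'\<in>D. poly_mapping.lookup (exponent_restrict (S d') f) t) =
        (\<Sum>d'\<in>D. if d' = d then poly_mapping.lookup f t else 0)"
      by (intro sum.cong) auto
    then show ?thesis using True d assms(1) by (simp add: lookup_sum sum.delta)
  next
    case False
    then show ?thesis by (simp add: lookup_sum)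
  qed
qed

text \<open>The ideals are parameters with defining equations, so that an interpretation speaks
  about the ideal powers literally as they occur in the theorem.\<close>

locale monomial_quotient =
  fixes V :: "'v set" and A B :: "('v \<Rightarrow>\<^sub>0 nat) set" and I J :: "('v, 'k::field) mpoly set"
  assumes A_add: "\<And>a b. a \<in> A \<Longrightarrow> a + b \<in> A"
    and B_add: "\<And>a b. a \<in> B \<Longrightarrow> a + b \<in> B"
    and B_subset: "B \<subseteq> A"
    and I_eq: "I = monomial_ideal V A"
    and J_eq: "J = monomial_ideal V B"
begin

abbreviation M :: "(('v, 'k) mpoly, ('v, 'k) mpoly set) module" where
  "M \<equiv> ideal_quotient V I J"

definition residue_class :: "('v, 'k) mpoly \<Rightarrow> ('v, 'k) mpoly set" where
  "residue_class f = J +>\<^bsub>mpoly_ring V\<^esub> f"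

lemma residue_class_eq: "residue_class f = (\<lambda>h. h + f) ` J"
  by (auto simp: residue_class_def a_r_coset_def')

lemma J_zero: "0 \<in> J"
  by (simp add: J_eq zero_in_monomial_ideal)

lemma J_add: "f \<in> J \<Longrightarrow> g \<in> J \<Longrightarrow> f + g \<in> J"
  by (simp add: J_eq monomial_ideal_add)

lemma J_uminus: "f \<in> J \<Longrightarrow> - f \<in> J"
  by (auto simp: J_eq monomial_ideal_def mpoly_ring_uminus_closed in_keys_iff)

lemma J_mult: "r \<in> carrier (mpoly_ring V) \<Longrightarrow> f \<in> J \<Longrightarrow> r * f \<in> J"
  using ideal.I_l_closed[OF ideal_monomial_ideal[OF B_add]] by (fastforce simp: J_eq)

lemma J_diff_commute: "f - g \<in> J \<Longrightarrow> g - f \<in> J"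
  using J_uminus[of "f - g"] by simp

lemma residue_class_eq_iff: "residue_class f = residue_class g \<longleftrightarrow> f - g \<in> J"
proof
  assume "residue_class f = residue_class g"
  moreover have "f \<in> residue_class f" using J_zero by (force simp: residue_class_eq)
  ultimately show "f - g \<in> J" by (auto simp: residue_class_eq)
next
  have sub: "residue_class f \<subseteq> residue_class g" if "f - g \<in> J" for f g
  proof
    fix x assume "x \<in> residue_class f"
    then obtain h where "h \<in> J" "x = h + f" by (auto simp: residue_class_eq)
    then have "x = (h + (f - g)) + g" "h + (f - g) \<in> J" using that J_add by simp_all
    then show "x \<in> residue_class g" unfolding residue_class_eq by blast
  qed
  assume "f - g \<in> J"
  then show "residue_class f = residue_class g" using sub J_diff_commute by blast
qed

lemma carrier_M: "carrier M = residue_class ` I"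
  by (auto simp: ideal_quotient_def quotient_module_def ideal_module_def A_RCOSETS_def'
      a_r_coset_def' residue_class_eq)

lemma zero_M: "zero M = residue_class 0"
  by (simp add: ideal_quotient_def quotient_module_def residue_class_eq)

lemma add_M: "residue_class f \<oplus>\<^bsub>M\<^esub> residue_class g = residue_class (f + g)"
proof -
  have "residue_class f \<oplus>\<^bsub>M\<^esub> residue_class g =
      {x + y |x y. x \<in> residue_class f \<and> y \<in> residue_class g}"
    by (auto simp: ideal_quotient_def quotient_module_def ideal_module_def set_add_def')
  also have "\<dots> = residue_class (f + g)"
  proof (intro equalityI subsetI)
    fix z assume "z \<in> {x + y |x y. x \<in> residue_class f \<and> y \<in> residue_class g}"
    then obtain h h' where "h \<in> J" "h' \<in> J" "z = h + f + (h' + g)" by (auto simp: residue_class_eq)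
    then have "z = (h + h') + (f + g)" "h + h' \<in> J" using J_add by (simp_all add: ac_simps)
    then show "z \<in> residue_class (f + g)" unfolding residue_class_eq by blast
  next
    fix z assume "z \<in> residue_class (f + g)"
    then obtain h where "h \<in> J" "z = (h + f) + (0 + g)" by (auto simp: residue_class_eq ac_simps)
    then show "z \<in> {x + y |x y. x \<in> residue_class f \<and> y \<in> residue_class g}"
      using J_zero unfolding residue_class_eq by blast
  qed
  finally show ?thesis .
qed

text \<open>The union in \<open>quotient_module\<close> runs over all representatives; its cosets
  coincide because \<open>J\<close> absorbs multiplication by \<open>r\<close>.\<close>

lemma smult_M:
  assumes "r \<in> carrier (mpoly_ring V)"
  shows "r \<odot>\<^bsub>M\<^esub> residue_class f = residue_class (r * f)"
proof -
  have "r \<odot>\<^bsub>M\<^esub> residue_class f = (\<Union>x\<in>residue_class f. residue_class (r * x))"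
    by (auto simp: ideal_quotient_def quotient_module_def ideal_module_def a_r_coset_def' residue_class_eq)
  also have "residue_class (r * x) = residue_class (r * f)" if "x \<in> residue_class f" for x
  proof -
    from that obtain h where h: "h \<in> J" "x = h + f" by (auto simp: residue_class_eq)
    then have "r * x - r * f = r * h" by (simp add: distrib_left)
    then show ?thesis using J_mult[OF assms h(1)] by (simp add: residue_class_eq_iff)
  qed
  then have "(\<Union>x\<in>residue_class f. residue_class (r * x)) = (\<Union>x\<in>residue_class f. residue_class (r * f))"
    by simp
  also have "\<dots> = residue_class (r * f)" using J_zero by (auto simp: residue_class_eq)
  finally show ?thesis .
qed

text \<open>Serves twice: with \<open>Z = V\<close> and \<open>U = I\<close> for the whole quotient,
  and with the span of a cone for a Stanley space.\<close>

lemma module_image: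
  assumes "Z \<subseteq> V" "0 \<in> U" "\<And>f g. f \<in> U \<Longrightarrow> g \<in> U \<Longrightarrow> f + g \<in> U"
    and "\<And>r f. r \<in> carrier (mpoly_ring Z) \<Longrightarrow> f \<in> U \<Longrightarrow> r * f \<in> U"
  shows "Module.module (mpoly_ring Z) (M\<lparr>carrier := residue_class ` U\<rparr>)"
    (is "Module.module ?R ?N")
proof -
  have neg: "- f \<in> U" if "f \<in> U" for f
    using assms(4)[OF mpoly_ring_uminus_closed[OF mpoly_ring_zero_one_closed(2)] that] by simp
  have scal: "r \<odot>\<^bsub>M\<^esub> residue_class f = residue_class (r * f)"
    if "r \<in> carrier ?R" for r f
    using smult_M that mpoly_ring_mono[OF assms(1)] by blast
  show ?thesis
  proof (rule moduleI)
    show "abelian_group ?N"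
    proof (rule abelian_groupI)
      fix x assume "x \<in> carrier ?N"
      then obtain f where "f \<in> U" "x = residue_class f" by auto
      then show "\<exists>y\<in>carrier ?N.
          y \<oplus>\<^bsub>?N\<^esub> x = \<zero>\<^bsub>?N\<^esub>"
        using neg[of f] by (intro bexI[of _ "residue_class (- f)"]) (simp_all add: add_M zero_M)
    next
      show "x \<oplus>\<^bsub>?N\<^esub> y \<in> carrier ?N" if "x \<in> carrier ?N" "y \<in> carrier ?N" for x y
        using that assms(3) by (auto simp: add_M)
      show "\<zero>\<^bsub>?N\<^esub> \<in> carrier ?N" using assms(2) by (simp add: zero_M)
      show "(x \<oplus>\<^bsub>?N\<^esub> y) \<oplus>\<^bsub>?N\<^esub> z = x \<oplus>\<^bsub>?N\<^esub> (y \<oplus>\<^bsub>?N\<^esub> z)"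
        if "x \<in> carrier ?N" "y \<in> carrier ?N" "z \<in> carrier ?N" for x y z
        using that by (auto simp: add_M add.assoc)
      show "x \<oplus>\<^bsub>?N\<^esub> y = y \<oplus>\<^bsub>?N\<^esub> x" if "x \<in> carrier ?N" "y \<in> carrier ?N" for x y
        using that by (auto simp: add_M add.commute)
      show "\<zero>\<^bsub>?N\<^esub> \<oplus>\<^bsub>?N\<^esub> x = x" if "x \<in> carrier ?N" for x
        using that by (auto simp: add_M zero_M)
    qed
    show "r \<odot>\<^bsub>?N\<^esub> x \<in> carrier ?N" if "r \<in> carrier ?R" "x \<in> carrier ?N" for r x
      using that assms(4) by (auto simp: scal)
    show "(r \<oplus>\<^bsub>?R\<^esub> s) \<odot>\<^bsub>?N\<^esub> x = (r \<odot>\<^bsub>?N\<^esub> x) \<oplus>\<^bsub>?N\<^esub> (s \<odot>\<^bsub>?N\<^esub> x)"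
      if "r \<in> carrier ?R" "s \<in> carrier ?R" "x \<in> carrier ?N" for r s x
      using that mpoly_ring_add_closed[of r Z s] by (auto simp: scal add_M distrib_right)
    show "r \<odot>\<^bsub>?N\<^esub> (x \<oplus>\<^bsub>?N\<^esub> y) = (r \<odot>\<^bsub>?N\<^esub> x) \<oplus>\<^bsub>?N\<^esub> (r \<odot>\<^bsub>?N\<^esub> y)"
      if "r \<in> carrier ?R" "x \<in> carrier ?N" "y \<in> carrier ?N" for r x y
      using that by (auto simp: scal add_M distrib_left)
    show "(r \<otimes>\<^bsub>?R\<^esub> s) \<odot>\<^bsub>?N\<^esub> x = r \<odot>\<^bsub>?N\<^esub> (s \<odot>\<^bsub>?N\<^esub> x)"
      if "r \<in> carrier ?R" "s \<in> carrier ?R" "x \<in> carrier ?N" for r s x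
      using that mpoly_ring_mult_closed[of r Z s] by (auto simp: scal mult.assoc)
    show "\<one>\<^bsub>?R\<^esub> \<odot>\<^bsub>?N\<^esub> x = x" if "x \<in> carrier ?N" for x
      using that by (auto simp: scal mpoly_ring_zero_one_closed)
  qed (rule cring_mpoly_ring)
qed

lemma module_M: "Module.module (mpoly_ring V) M"
proof -
  have "r * f \<in> I" if "r \<in> carrier (mpoly_ring V)" "f \<in> I" for r f
    using that ideal.I_l_closed[OF ideal_monomial_ideal[OF A_add]] by (fastforce simp: I_eq)
  then have "Module.module (mpoly_ring V) (M\<lparr>carrier := residue_class ` I\<rparr>)"
    by (intro module_image) (auto simp: I_eq zero_in_monomial_ideal monomial_ideal_add)
  then show ?thesis by (simp flip: carrier_M)
qed

lemma finsum_M: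
  assumes "finite D" "\<And>d. d \<in> D \<Longrightarrow> g d \<in> I"
  shows "(\<Oplus>\<^bsub>M\<^esub>d\<in>D. residue_class (g d)) = residue_class (\<Sum>d\<in>D. g d)"
proof -
  interpret M: abelian_group M
    by (rule Module.module.axioms(2)[OF module_M])
  show ?thesis
    using assms
  proof (induction D rule: finite_induct)
    case empty
    then show ?case by (simp add: zero_M)
  next
    case (insert d D)
    then have "(\<lambda>d. residue_class (g d)) \<in> insert d D \<rightarrow> carrier M" by (auto simp: carrier_M)
    with insert show ?case by (simp add: Pi_def add_M)
  qed
qed

text \<open>The monomials with these exponents represent a vector space basis of \<open>I / J\<close>.\<close>

definition standard_exponents :: "('v \<Rightarrow>\<^sub>0 nat) set" where
  "standard_exponents = {a \<in> A - B. Poly_Mapping.keys a \<subseteq> V}"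

lemma standard_in_I: "Poly_Mapping.keys f \<subseteq> standard_exponents \<Longrightarrow> f \<in> I"
  by (auto simp: standard_exponents_def I_eq monomial_ideal_def carrier_mpoly_ring_iff)

lemma J_lookup_standard: "f \<in> J \<Longrightarrow> t \<in> standard_exponents \<Longrightarrow> poly_mapping.lookup f t = 0"
  by (auto simp: standard_exponents_def J_eq monomial_ideal_def simp flip: not_in_keys_iff_lookup_eq_zero)

lemma J_standard_zero:
  assumes "f \<in> J" "Poly_Mapping.keys f \<subseteq> standard_exponents" shows "f = 0"
  using assms J_lookup_standard by (metis in_keys_iff keys_eq_empty subset_iff ex_in_conv)

text \<open>Here \<open>exponent_restrict\<close> acts on polynomials and selects monomials. The
  discarded monomials have exponents in \<open>B\<close> and thus lie in \<open>J\<close>. This is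
  the spanning half of the basis property; \<open>J_standard_zero\<close> is the independence
  half.\<close>

lemma residue_class_restrict:
  assumes "f \<in> I"
  shows "residue_class (exponent_restrict standard_exponents f) = residue_class f"
  unfolding residue_class_eq_iff
proof (rule J_diff_commute)
  have "Poly_Mapping.keys (f - exponent_restrict standard_exponents f) \<subseteq> Poly_Mapping.keys f - standard_exponents"
    by (auto simp: in_keys_iff lookup_minus split: if_splits)
  then show "f - exponent_restrict standard_exponents f \<in> J"
    using assms unfolding J_eq I_eq monomial_ideal_def standard_exponents_def carrier_mpoly_ring_iff
      by blast
qed

section \<open>Stanley spaces and decompositions from cones\<close>

lemma stanley_subspace_monomial:
  assumes "snd d \<subseteq> V"
  shows "stanley_subspace M (residue_class (Poly_Mapping.single (fst d) 1)) (snd d) =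
    residue_class ` {f. Poly_Mapping.keys f \<subseteq> stanley_cone d}"
proof -
  have "v \<odot>\<^bsub>M\<^esub> residue_class (Poly_Mapping.single (fst d) 1) =
      residue_class (v * Poly_Mapping.single (fst d) 1)"
    if "v \<in> carrier (mpoly_ring (snd d))" for v
    using that mpoly_ring_mono[OF assms] by (intro smult_M) blast
  then have "stanley_subspace M (residue_class (Poly_Mapping.single (fst d) 1)) (snd d) =
      {residue_class (v * Poly_Mapping.single (fst d) 1) |v. v \<in> carrier (mpoly_ring (snd d))}"
    unfolding stanley_subspace_def by (intro Collect_cong) metis
  also have "\<dots> = residue_class ` {f. Poly_Mapping.keys f \<subseteq> stanley_cone d}"
    unfolding keys_subset_stanley_cone_iff by blast
  finally show ?thesis .
qed

text \<open>The class of \<open>x^u\<close> is a one-element basis: multiplication by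
  \<open>x^u\<close> is injective, and since the cone is standard no nonzero multiple of
  \<open>x^u\<close> by an element of \<open>K[Z]\<close> falls into \<open>J\<close>.\<close>

lemma is_stanley_space_monomial:
  assumes Z: "snd d \<subseteq> V" and cone: "stanley_cone d \<subseteq> standard_exponents"
  shows "is_stanley_space V M (ideal_quotient_component V I J)
    (residue_class (Poly_Mapping.single (fst d) 1)) (snd d)"
proof -
  let ?u = "Poly_Mapping.single (fst d) (1::'k)"
  let ?R = "mpoly_ring (snd d) :: ('v, 'k) mpoly ring"
  let ?U = "{f :: ('v, 'k) mpoly. Poly_Mapping.keys f \<subseteq> stanley_cone d}"
  let ?N = "M\<lparr>carrier := residue_class ` ?U\<rparr>"
  have u: "fst d \<in> standard_exponents" using fst_in_stanley_cone cone by blast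
  then have uI: "?u \<in> I" by (intro standard_in_I) simp
  have uV: "Poly_Mapping.keys (fst d) \<subseteq> V" using u by (simp add: standard_exponents_def)
  let ?a = "Poly_Mapping.map int (fst d)"
  have "Poly_Mapping.keys ?a \<subseteq> V"
    using uV by (auto simp: in_keys_iff map.rep_eq when_def split: if_splits)
  moreover have "residue_class ?u \<in> ideal_quotient_component V I J ?a"
    using uI uV unfolding ideal_quotient_component_def residue_class_def
    by (intro imageI) (simp add: mpoly_component_def carrier_mpoly_ring_iff)
  moreover have "free_module ?R ?N"
  proof -
    have U_mult: "r * f \<in> ?U" if r: "r \<in> carrier ?R" and f: "f \<in> ?U" for r f
    proof -
      obtain v where "v \<in> carrier ?R" "f = v * ?u"
        using f unfolding keys_subset_stanley_cone_iff by blast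
      then have "r * f = (r * v) * ?u" "r * v \<in> carrier ?R"
        using r mpoly_ring_mult_closed by (auto simp: mult.assoc)
      then show ?thesis using keys_subset_stanley_cone_iff[of "r * f" d] by blast
    qed
    have mod: "Module.module ?R ?N"
    proof (rule module_image[OF Z])
      show "f + g \<in> ?U" if "f \<in> ?U" "g \<in> ?U" for f g
        using that Poly_Mapping.keys_add[of f g] by blast
    qed (use U_mult in auto)
    interpret N: abelian_group ?N by (rule Module.module.axioms(2)[OF mod])
    have scal: "v \<odot>\<^bsub>M\<^esub> residue_class ?u = residue_class (v * ?u)" if "v \<in> carrier ?R" for v
      using that mpoly_ring_mono[OF Z] by (intro smult_M) blast
    have vU: "v * ?u \<in> ?U" if "v \<in> carrier ?R" for v
      using that keys_subset_stanley_cone_iff by blast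
    have inj: "v = w" if vw: "v \<in> carrier ?R" "w \<in> carrier ?R"
        and "residue_class (v * ?u) = residue_class (w * ?u)" for v w
    proof -
      have "v * ?u - w * ?u \<in> J" using that residue_class_eq_iff by blast
      moreover have "Poly_Mapping.keys (v * ?u - w * ?u) \<subseteq> standard_exponents"
        using vU[OF vw(1)] vU[OF vw(2)] keys_diff[of "v * ?u" "w * ?u"] cone by blast
      ultimately have "v * ?u = w * ?u" using J_standard_zero by fastforce
      then show ?thesis by (metis lookup_mult_monomial poly_mapping_eqI)
    qed
    define b where "b = residue_class ?u"
    have b: "b \<in> residue_class ` ?U"
      unfolding b_def using fst_in_stanley_cone[of d] by (intro imageI) simp
    \<comment> \<open>A zero coefficient removes \<open>b\<close> from the index set; the empty sum
      is the zero coset, in agreement with \<open>0 * ?u = 0\<close>.\<close>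
    have sum: "(\<Oplus>\<^bsub>?N\<^esub>x\<in>{x\<in>{b}. c x \<noteq> \<zero>\<^bsub>?R\<^esub>}. c x \<odot>\<^bsub>?N\<^esub> x) = residue_class (c b * ?u)"
      if "c b \<in> carrier ?R" for c
    proof (cases "c b = 0")
      case True
      then have "{x\<in>{b}. c x \<noteq> \<zero>\<^bsub>?R\<^esub>} = {}" by auto
      then show ?thesis using True by (simp only: N.finsum_empty) (simp add: zero_M)
    next
      case False
      then have "{x\<in>{b}. c x \<noteq> \<zero>\<^bsub>?R\<^esub>} = {b}" by auto
      moreover have "c b \<odot>\<^bsub>M\<^esub> b = residue_class (c b * ?u)" using scal[OF that] by (simp add: b_def)
      ultimately show ?thesis using vU[OF that]
        by (subst \<open>{x\<in>{b}. c x \<noteq> \<zero>\<^bsub>?R\<^esub>} = {b}\<close>, subst N.finsum_insert) (auto simp: add_M zero_M)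
    qed
    have "\<exists>!c. c \<in> {b} \<rightarrow>\<^sub>E carrier ?R \<and> finite {x\<in>{b}. c x \<noteq> \<zero>\<^bsub>?R\<^esub>} \<and>
        x = (\<Oplus>\<^bsub>?N\<^esub>x\<in>{x\<in>{b}. c x \<noteq> \<zero>\<^bsub>?R\<^esub>}. c x \<odot>\<^bsub>?N\<^esub> x)"
      if x: "x \<in> carrier ?N" for x
    proof -
      obtain v where v: "v \<in> carrier ?R" "x = residue_class (v * ?u)"
        using x by (auto simp: keys_subset_stanley_cone_iff)
      show ?thesis
      proof (rule ex1I[of _ "\<lambda>y\<in>{b}. v"])
        show "(\<lambda>y\<in>{b}. v) \<in> {b} \<rightarrow>\<^sub>E carrier ?R \<and> finite {x\<in>{b}. (\<lambda>y\<in>{b}. v) x \<noteq> \<zero>\<^bsub>?R\<^esub>} \<and>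
            x = (\<Oplus>\<^bsub>?N\<^esub>x\<in>{x\<in>{b}. (\<lambda>y\<in>{b}. v) x \<noteq> \<zero>\<^bsub>?R\<^esub>}. (\<lambda>y\<in>{b}. v) x \<odot>\<^bsub>?N\<^esub> x)"
          using v by (subst sum) auto
        fix c assume c: "c \<in> {b} \<rightarrow>\<^sub>E carrier ?R \<and> finite {x\<in>{b}. c x \<noteq> \<zero>\<^bsub>?R\<^esub>} \<and>
            x = (\<Oplus>\<^bsub>?N\<^esub>x\<in>{x\<in>{b}. c x \<noteq> \<zero>\<^bsub>?R\<^esub>}. c x \<odot>\<^bsub>?N\<^esub> x)"
        have cE: "c \<in> {b} \<rightarrow>\<^sub>E carrier ?R" using c by (rule conjunct1)
        then have cb: "c b \<in> carrier ?R" by auto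
        have "x = residue_class (c b * ?u)"
          using conjunct2[OF conjunct2[OF c]] sum[of c, OF cb] by (rule trans)
        with v(2) have "residue_class (c b * ?u) = residue_class (v * ?u)" by (simp only:)
        with cb v(1) have "c b = v" by (rule inj)
        show "c = (\<lambda>y\<in>{b}. v)"
        proof
          fix y show "c y = (\<lambda>y\<in>{b}. v) y"
            using PiE_arb[OF cE] \<open>c b = v\<close> by (cases "y = b") auto
        qed
      qed
    qed
    moreover have "{b} \<subseteq> carrier ?N" using b by simp
    ultimately show ?thesis
      unfolding free_module_def using mod by (intro conjI exI[of _ "{b}"] ballI)
  qed
  ultimately show ?thesis
    unfolding is_stanley_space_def stanley_subspace_monomial[OF Z]
      using Z uI by (auto simp: carrier_M)
qed

text \<open>Cutting a representative along the disjoint cones yields the summands. Elements of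
  \<open>J\<close> have coefficient 0 at standard exponents, so the coefficients there depend only
  on the class, which gives uniqueness.\<close>

lemma stanley_decomposition_monomial:
  assumes fin: "finite D" and Z: "\<And>d. d \<in> D \<Longrightarrow> snd d \<subseteq> V"
    and cover: "standard_exponents = (\<Union>d\<in>D. stanley_cone d)"
    and disj: "disjoint_family_on stanley_cone D"
  shows "stanley_decomposition V M (ideal_quotient_component V I J)
    ((\<lambda>d. (residue_class (Poly_Mapping.single (fst d) 1), snd d)) ` D)"
proof -
  define h where
    "h = (\<lambda>d :: ('v \<Rightarrow>\<^sub>0 nat) \<times> 'v set. (residue_class (Poly_Mapping.single (fst d) (1::'k)), snd d))"
  define D' where "D' = h ` D"
  let ?space = "\<lambda>(u, Z). stanley_subspace M u Z"
  have cone: "stanley_cone d \<subseteq> standard_exponents" if "d \<in> D" for d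
    using cover that by blast
  \<comment> \<open>A decomposition is a set of pairs, so no two cones may collapse into one pair.
    Their origins are standard, and distinct standard monomials are incongruent modulo
    \<open>J\<close>.\<close>
  have inj: "inj_on h D"
  proof (rule inj_onI)
    fix d d' assume d: "d \<in> D" "d' \<in> D" "h d = h d'"
    let ?f = "Poly_Mapping.single (fst d) (1::'k) - Poly_Mapping.single (fst d') 1"
    have "?f \<in> J" using d(3) residue_class_eq_iff by (simp add: h_def)
    moreover have "Poly_Mapping.keys ?f \<subseteq> standard_exponents"
      using keys_diff[of "Poly_Mapping.single (fst d) (1::'k)" "Poly_Mapping.single (fst d') 1"]
        fst_in_stanley_cone[of d] fst_in_stanley_cone[of d'] cone[OF d(1)] cone[OF d(2)] by auto
    ultimately have "?f = 0" by (rule J_standard_zero)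
    then have "Poly_Mapping.keys (Poly_Mapping.single (fst d) (1::'k)) =
        Poly_Mapping.keys (Poly_Mapping.single (fst d') (1::'k))" by simp
    then have "fst d = fst d'" by simp
    then show "d = d'" using d(3) by (simp add: h_def prod_eq_iff)
  qed
  define e where "e = inv_into D h"
  have eh: "e (h d) = d" if "d \<in> D" for d unfolding e_def by (rule inv_into_f_f[OF inj that])
  have space: "?space p = residue_class ` {f. Poly_Mapping.keys f \<subseteq> stanley_cone (e p)}"
    if "p \<in> D'" for p
  proof -
    obtain d where d: "d \<in> D" "p = h d" using \<open>p \<in> D'\<close> by (auto simp: D'_def)
    then show ?thesis using stanley_subspace_monomial[OF Z[OF d(1)]] eh by (simp add: h_def)
  qed
  have eD: "e p \<in> D" if "p \<in> D'" for p using that eh by (auto simp: D'_def)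
  have e_inj: "inj_on e (D')" unfolding e_def D'_def by (rule inj_on_inv_into) (rule order_refl)
  have disj': "disjoint_family_on (\<lambda>p. stanley_cone (e p)) (D')"
    unfolding disjoint_family_on_def
  proof (intro ballI impI)
    fix p q assume pq: "p \<in> D'" "q \<in> D'" "p \<noteq> q"
    then have "e p \<noteq> e q" using inj_onD[OF e_inj _ pq(1,2)] by iprover
    with disj eD[OF pq(1)] eD[OF pq(2)] show "stanley_cone (e p) \<inter> stanley_cone (e q) = {}"
      by (rule disjoint_family_onD)
  qed
  have cover': "(\<Union>p\<in>D'. stanley_cone (e p)) = standard_exponents"
    unfolding cover D'_def image_image by (intro SUP_cong refl) (simp only: eh)
  have finD': "finite D'" using fin by (simp add: D'_def)
  have "\<exists>!w. w \<in> Pi\<^sub>E (D') ?space \<and> m = (\<Oplus>\<^bsub>M\<^esub>p\<in>D'. w p)"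
    if m: "m \<in> carrier M" for m
  proof -
    obtain f where f: "f \<in> I" "m = residue_class f" using m by (auto simp: carrier_M)
    define g where "g p = exponent_restrict (stanley_cone (e p)) f"
      for p :: "('v, 'k) mpoly set \<times> 'v set"
    have M_sum: "(\<Oplus>\<^bsub>M\<^esub>p\<in>D'. w p) = residue_class (\<Sum>p\<in>D'. g' p)"
      if "\<And>p. p \<in> D' \<Longrightarrow> w p = residue_class (g' p)"
        "\<And>p. p \<in> D' \<Longrightarrow> Poly_Mapping.keys (g' p) \<subseteq> stanley_cone (e p)" for w g'
    proof -
      interpret M: abelian_group M by (rule Module.module.axioms(2)[OF module_M])
      have g'I: "g' p \<in> I" if "p \<in> D'" for p
        using \<open>\<And>p. p \<in> D' \<Longrightarrow> Poly_Mapping.keys (g' p) \<subseteq> stanley_cone (e p)\<close>[OF that] cone[OF eD[OF that]]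
        by (intro standard_in_I) blast
      have "(\<Oplus>\<^bsub>M\<^esub>p\<in>D'. w p) = (\<Oplus>\<^bsub>M\<^esub>p\<in>D'. residue_class (g' p))"
        using that(1) g'I by (intro M.finsum_cong') (auto simp: carrier_M)
      also have "\<dots> = residue_class (\<Sum>p\<in>D'. g' p)"
        using finD' g'I by (intro finsum_M) auto
      finally show ?thesis .
    qed
    show ?thesis
    proof (rule ex1I[of _ "\<lambda>p\<in>D'. residue_class (g p)"], intro conjI)
      show "(\<lambda>p\<in>D'. residue_class (g p)) \<in> Pi\<^sub>E (D') ?space"
        unfolding restrict_PiE_iff
      proof
        fix p assume p: "p \<in> D'"
        show "residue_class (g p) \<in> ?space p"
          unfolding space[OF p] by (intro imageI CollectI) (simp add: g_def)
      qed
      have "(\<Oplus>\<^bsub>M\<^esub>p\<in>D'. (\<lambda>p\<in>D'. residue_class (g p)) p) = residue_class (\<Sum>p\<in>D'. g p)"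
        by (rule M_sum) (auto simp: g_def)
      also have "(\<Sum>p\<in>D'. g p) = exponent_restrict standard_exponents f"
        unfolding g_def
          using finD' by (subst sum_exponent_restrict[OF _ disj']) (simp_all add: cover')
      also have "residue_class \<dots> = m" using residue_class_restrict f by simp
      finally show "m = (\<Oplus>\<^bsub>M\<^esub>p\<in>D'. (\<lambda>p\<in>D'. residue_class (g p)) p)" by simp
    next
      fix w assume w: "w \<in> Pi\<^sub>E (D') ?space \<and> m = (\<Oplus>\<^bsub>M\<^esub>p\<in>D'. w p)"
      have "\<forall>p\<in>D'. \<exists>f. w p = residue_class f \<and> Poly_Mapping.keys f \<subseteq> stanley_cone (e p)"
      proof
        fix p assume p: "p \<in> D'"
        then have "w p \<in> ?space p" using w by (blast dest: PiE_mem)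
        then show "\<exists>f. w p = residue_class f \<and> Poly_Mapping.keys f \<subseteq> stanley_cone (e p)"
          unfolding space[OF p] by blast
      qed
      then obtain g' where g': "\<And>p. p \<in> D' \<Longrightarrow> w p = residue_class (g' p)"
        "\<And>p. p \<in> D' \<Longrightarrow> Poly_Mapping.keys (g' p) \<subseteq> stanley_cone (e p)"
        by metis
      have "residue_class f = residue_class (\<Sum>p\<in>D'. g' p)"
        using w f(2) M_sum[OF g'] by simp
      then have diff: "f - (\<Sum>p\<in>D'. g' p) \<in> J" by (simp add: residue_class_eq_iff)
      \<comment> \<open>At an exponent in the cone of \<open>p\<close> only \<open>g' p\<close>
        contributes to the sum, by disjointness, and \<open>diff\<close> makes its coefficient agree
        with that of \<open>f\<close>. Off the cone both sides vanish.\<close>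
      have "g' p = g p" if p: "p \<in> D'" for p
      proof (rule poly_mapping_eqI)
        fix t
        show "poly_mapping.lookup (g' p) t = poly_mapping.lookup (g p) t"
        proof (cases "t \<in> stanley_cone (e p)")
          case True
          have "poly_mapping.lookup (g' p') t = (if p' = p then poly_mapping.lookup (g' p) t else 0)"
            if "p' \<in> D'" for p'
            using g'(2)[OF that] disj' True p that unfolding disjoint_family_on_def
            by (auto simp flip: not_in_keys_iff_lookup_eq_zero)
          then have "poly_mapping.lookup (\<Sum>p\<in>D'. g' p) t =
              (\<Sum>p'\<in>D'. if p' = p then poly_mapping.lookup (g' p) t else 0)"
            unfolding lookup_sum by (intro sum.cong) auto
          also have "\<dots> = poly_mapping.lookup (g' p) t" using finD' p by (simp add: sum.delta)
          finally have "poly_mapping.lookup (g' p) t = poly_mapping.lookup f t"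
            using J_lookup_standard[OF diff, of t] True cone[OF eD[OF p]]
              by (auto simp: lookup_minus)
          then show ?thesis using True by (simp add: g_def)
        next
          case False
          then show ?thesis
            using g'(2)[OF p] by (auto simp: g_def simp flip: not_in_keys_iff_lookup_eq_zero)
        qed
      qed
      then show "w = (\<lambda>p\<in>D'. residue_class (g p))"
        using w g'(1)
          by (intro PiE_ext[of w "D'" ?space]) (auto simp: restrict_def PiE_iff extensional_def)
    qed
  qed
  then show ?thesis
    unfolding stanley_decomposition_def
    using finD' is_stanley_space_monomial[OF Z cone] by (auto simp: D'_def h_def)
qed

text \<open>An empty \<open>D\<close> has infimum \<open>\<infinity>\<close>, so the zero module is
  included.\<close>

lemma sdepth_ge:
  assumes "stanley_partition V standard_exponents n"
  shows "enat n \<le> sdepth V M (ideal_quotient_component V I J)"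
proof -
  obtain D where D: "finite D" "\<forall>d\<in>D. snd d \<subseteq> V \<and> n \<le> card (snd d)"
    "standard_exponents = (\<Union>d\<in>D. stanley_cone d)" "disjoint_family_on stanley_cone D"
    using assms unfolding stanley_partition_def by (elim exE conjE)
  let ?D = "(\<lambda>d. (residue_class (Poly_Mapping.single (fst d) (1::'k)), snd d)) ` D"
  have "stanley_decomposition V M (ideal_quotient_component V I J) ?D"
    using stanley_decomposition_monomial[OF D(1) _ D(3,4)] D(2) by blast
  moreover have "enat n \<le> sdepth_decomposition ?D"
    unfolding sdepth_decomposition_def
    by (rule INF_greatest) (use D(2) in auto)
  ultimately show ?thesis unfolding sdepth_def by (intro SUP_upper2[of ?D]) simp_all
qed

end

theorem theorem2p2:
  fixes V :: "'v set" and E :: "'v set set"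
    and I :: "('v, 'k::field) mpoly set" and p k :: nat
  assumes "simple_graph V E"
    and "I = edge_ideal V E"
    and "p = card {C \<in> graph_components V E. bipartite_on E C}"
  shows "sdepth V
           (ideal_quotient V (ideal_power (mpoly_ring V) I k) (ideal_power (mpoly_ring V) I (k + 1)))
           (ideal_quotient_component V (ideal_power (mpoly_ring V) I k)
              (ideal_power (mpoly_ring V) I (k + 1)))
         \<ge> enat p"
proof -
  note power = ideal_power_edge_ideal[OF assms(1)]
  interpret monomial_quotient V "power_exponents E k" "power_exponents E (k + 1)"
    "ideal_power (mpoly_ring V) I k" "ideal_power (mpoly_ring V) I (k + 1)"
    by unfold_locales
      (use power_exponents_add_right power_exponents_antimono[of k "k + 1" E] in
        \<open>auto simp: assms(2) power\<close>)
  have "standard_exponents = level_exponents V E k"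
    using le_edge_order_iff[OF assms(1), of k] le_edge_order_iff[OF assms(1), of "k + 1"]
    unfolding standard_exponents_def level_exponents_def by force
  then show ?thesis
    using stanley_partition_level_exponents[OF assms(1), of k] assms(3) by (intro sdepth_ge) simp
qed

end
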